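(* For a set $S$ with $|S|=n$ and $q \sim \mathcal{U}([n]^{S\times\{0,1\}})$, let $G_q$ be the multigraph on node set $[n]$ with one edge $\{q(x,0),q(x,1)\}$ for each $x\in S$, and let $c(G_q)$ be its number of connected components. Then $$\mathbb{P}\left[c(G_q) \ge \tfrac{1}{8}\ln(n) \,\middle|\, G_q \text{ is a pseudoforest}\right] \in \Omega_{n\to\infty}(1).$$
   Context: $[n]=\{1,\ldots,n\}$; $\mathcal{U}(X)$ is the uniform distribution on $X$. Loops and multiple edges are allowed in $G_q$. A pseudoforest is a multigraph in which every connected component contains exactly one cycle, i.e. has as many edges as nodes (a loop counts as a cycle of length 1, a pair of parallel edges as a cycle of length 2). *)

theory Defs
  imports "HOL-Probability.Probability"
begin

text \<open>
  Multigraphs with loops and parallel edges: edges are abstract labels, and \<open>ends\<close> sends each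
  label to its set of end nodes, a singleton exactly for loops.
\<close>

record ('v, 'e) multigraph =
  nodes :: "'v set"
  edges :: "'e set"
  ends :: "'e \<Rightarrow> 'v set"

definition adjacency :: "('v, 'e) multigraph \<Rightarrow> ('v \<times> 'v) set" where
  "adjacency G = {(u, v). \<exists>e\<in>edges G. ends G e = {u, v}}"

definition multigraph_components :: "('v, 'e) multigraph \<Rightarrow> 'v set set" where
  "multigraph_components G = nodes G // (adjacency G)\<^sup>*"

text \<open>
  A cycle of length \<open>k \<ge> 1\<close> passes through distinct nodes \<open>v\<^sub>0, \<dots>, v\<^bsub>k-1\<^esub>\<close> along distinct edges
  \<open>e\<^sub>0, \<dots>, e\<^bsub>k-1\<^esub>\<close>, where \<open>e\<^sub>i\<close> joins \<open>v\<^sub>i\<close> and \<open>v\<^bsub>i+1 mod k\<^esub>\<close>. So \<open>k = 1\<close> is a loop and \<open>k = 2\<close> a pair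
  of parallel edges. A cycle is identified with its edge set, so that starting point and
  direction of traversal do not matter when cycles are counted.
\<close>

definition is_cycle :: "('v, 'e) multigraph \<Rightarrow> 'e set \<Rightarrow> bool" where
  "is_cycle G C \<longleftrightarrow>
     (\<exists>vs es. es \<noteq> [] \<and> length vs = length es \<and> distinct vs \<and> distinct es \<and>
        set vs \<subseteq> nodes G \<and> set es \<subseteq> edges G \<and> C = set es \<and>
        (\<forall>i<length es. ends G (es ! i) = {vs ! i, vs ! (Suc i mod length es)}))"

definition pseudoforest :: "('v, 'e) multigraph \<Rightarrow> bool" where
  "pseudoforest G \<longleftrightarrow>
     (\<forall>K\<in>multigraph_components G. \<exists>!C. is_cycle G C \<and> (\<Union>e\<in>C. ends G e) \<subseteq> K)"

definition hash_graph :: "nat \<Rightarrow> 'a set \<Rightarrow> ('a \<times> nat \<Rightarrow> nat) \<Rightarrow> (nat, 'a) multigraph" where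
  "hash_graph n S q = \<lparr>nodes = {1..n}, edges = S, ends = (\<lambda>x. {q (x, 0), q (x, 1)})\<rparr>"

text \<open>The extensional function space makes the sample space finite, with \<open>n ^ (2 * card S)\<close> elements.\<close>

definition random_hash :: "nat \<Rightarrow> 'a set \<Rightarrow> ('a \<times> nat \<Rightarrow> nat) pmf" where
  "random_hash n S = pmf_of_set (S \<times> {0, 1} \<rightarrow>\<^sub>E {1..n})"

end

theory Submission
  imports Defs "HOL-Combinatorics.Orbits" "HOL-Library.Discrete_Functions"
begin

text \<open>
  Orient each edge so that every node is the tail of exactly one edge. Such an orientation turns \<open>G\<^sub>q\<close>
  into the graph of a function \<open>f\<close> on \<open>[n]\<close>; it exists iff \<open>G\<^sub>q\<close> is a pseudoforest, and then
  there are \<open>2\<close> choices for each cycle, \<open>2 ^ c(G\<^sub>q)\<close> in total. Double counting pairs of a hash function and an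
  orientation therefore gives, with a factor \<open>M\<close> independent of \<open>z\<close>,
  \<open>\<Sum>q pseudoforest. (2 z) ^ c(G\<^sub>q) = M * (\<Sum>f. z ^ c(f))\<close>.

  The right-hand side is found by revealing \<open>f\<close> along paths: up to the factor \<open>n ^ n\<close> it is the mean of
  \<open>z (z + 1) \<dots> (z + m - 1) / m!\<close>, where \<open>m\<close> is distributed as the number of cyclic nodes of a random \<open>f\<close>.
  As \<open>m\<close> is of order \<open>sqrt n\<close>, the mean is of order \<open>n powr ((z - 1) / 2)\<close>. Markov's inequality for
  \<open>(1/2) ^ c\<close>, that is \<open>z = 1/2\<close> against \<open>z = 1/4\<close>, bounds the conditional probability of fewer than
  \<open>ln n / 8\<close> components by a constant times \<open>n powr (- (1 - ln 2) / 8)\<close>.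
\<close>

section \<open>Components of functional graphs\<close>

text \<open>Only images of nodes in \<open>D\<close> count, because functions are later revealed
  node by node. Comparing unordered pairs, as \<open>adjacency\<close> does, makes the relation
  symmetric.\<close>

definition fgraph :: "'v set \<Rightarrow> ('v \<Rightarrow> 'v) \<Rightarrow> ('v \<times> 'v) set" where
  "fgraph D f = {(u, v). \<exists>w\<in>D. {w, f w} = {u, v}}"

definition component_count :: "'v set \<Rightarrow> ('v \<times> 'v) set \<Rightarrow> nat" where
  "component_count V R = card (V // R\<^sup>*)"

lemma sym_fgraph: "sym (fgraph D f)"
  unfolding fgraph_def sym_def by (simp add: insert_commute)

lemma fgraph_cong: "(\<And>x. x \<in> D \<Longrightarrow> f x = g x) \<Longrightarrow> fgraph D f = fgraph D g"
  unfolding fgraph_def by auto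

lemma fgraph_insert:
  "v \<notin> D \<Longrightarrow> fgraph (insert v D) (g(v := u)) = insert (v, u) (insert (u, v) (fgraph D g))"
  unfolding fgraph_def by (auto simp: doubleton_eq_iff)

lemma fgraph_subset: "f ` D \<subseteq> V \<Longrightarrow> D \<subseteq> V \<Longrightarrow> fgraph D f \<subseteq> V \<times> V"
  unfolding fgraph_def by (auto simp: doubleton_eq_iff)

lemma sym_star_image_eq:
  assumes "sym R" "(x, y) \<in> R\<^sup>*"
  shows "R\<^sup>* `` {x} = R\<^sup>* `` {y}"
proof -
  have "(y, x) \<in> R\<^sup>*" using assms by (meson sym_rtrancl symD)
  then show ?thesis using assms(2) by (auto intro: rtrancl_trans[of x y] rtrancl_trans[of y x])
qed

lemma rtrancl_closed:
  assumes "(x, y) \<in> R\<^sup>*" "R `` K \<subseteq> K" "x \<in> K"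
  shows "y \<in> K"
  using assms by (induction rule: rtrancl_induct) auto

text \<open>The new edge merges the classes of \<open>u\<close> and \<open>v\<close> if they differ
  and changes nothing otherwise. The additive form avoids subtraction on natural numbers.\<close>

lemma component_count_add_edge:
  assumes "finite V" "R \<subseteq> V \<times> V" "sym R" "u \<in> V" "v \<in> V"
  shows "component_count V R = component_count V (insert (u, v) (insert (v, u) R)) + (if (u, v) \<in> R\<^sup>* then 0 else 1)"
proof -
  let ?R = "insert (u, v) (insert (v, u) R)"
  have s: "(x, y) \<in> R\<^sup>* \<Longrightarrow> (y, x) \<in> R\<^sup>*" for x y
    using assms(3) by (meson sym_rtrancl symD)
  have t: "(x, y) \<in> R\<^sup>* \<Longrightarrow> (y, z) \<in> R\<^sup>* \<Longrightarrow> (x, z) \<in> R\<^sup>*" for x y z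
    by (rule rtrancl_trans)
  \<comment> \<open>A path through the new edge can be shortened so that it uses this edge once, in
    one of the two directions.\<close>
  have star: "(x, y) \<in> ?R\<^sup>* \<longleftrightarrow> (x, y) \<in> R\<^sup>* \<or> (x, u) \<in> R\<^sup>* \<and> (v, y) \<in> R\<^sup>* \<or> (x, v) \<in> R\<^sup>* \<and> (u, y) \<in> R\<^sup>*" for x y
    unfolding rtrancl_insert using t[of x u y] t[of x v y] by auto
  show ?thesis
  proof (cases "(u, v) \<in> R\<^sup>*")
    case True
    have "(x, y) \<in> ?R\<^sup>* \<longleftrightarrow> (x, y) \<in> R\<^sup>*" for x y
      unfolding star using True s[OF True] t[of x u v] t[of x v y] t[of x v u] t[of x u y] by auto
    then have "?R\<^sup>* = R\<^sup>*" by auto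
    with True show ?thesis by (simp add: component_count_def)
  next
    case False
    let ?c = "\<lambda>x. R\<^sup>* `` {x}"
    have cls: "?R\<^sup>* `` {x} = (if x \<in> ?c u \<union> ?c v then ?c u \<union> ?c v else ?c x)" for x
    proof -
      have "(x, y) \<in> ?R\<^sup>* \<longleftrightarrow> y \<in> (if x \<in> ?c u \<union> ?c v then ?c u \<union> ?c v else ?c x)" for y
        unfolding star using s[of x u] s[of u x] s[of x v] s[of v x] t[of x u y] t[of x v y] t[of u x y] t[of v x y]
        by auto
      then show ?thesis by blast
    qed
    have ceq: "?c x = ?c y \<longleftrightarrow> (x, y) \<in> R\<^sup>*" for x y
      using sym_star_image_eq[OF assms(3)] by blast
    have fin: "finite (V // R\<^sup>*)"
      using assms(1) by (simp add: quotient_def)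
    have uv: "?c u \<in> V // R\<^sup>*" "?c v \<in> V // R\<^sup>*" "?c u \<noteq> ?c v"
      using assms False by (simp_all only: ceq quotientI not_False_eq_True)
    \<comment> \<open>If the merged class were an old one, \<open>u\<close> and \<open>v\<close>
      would already be connected. So two classes are replaced by exactly one.\<close>
    have new: "?c u \<union> ?c v \<notin> V // R\<^sup>*"
    proof
      assume "?c u \<union> ?c v \<in> V // R\<^sup>*"
      then obtain x where "?c u \<union> ?c v = ?c x" by (auto elim: quotientE)
      then have "(x, u) \<in> R\<^sup>*" "(x, v) \<in> R\<^sup>*"
        by (metis Image_singleton_iff UnCI rtrancl.rtrancl_refl)+
      then show False using False s t by metis
    qed
    have eq: "V // ?R\<^sup>* = insert (?c u \<union> ?c v) (V // R\<^sup>* - {?c u, ?c v})"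
    proof (intro set_eqI iffI)
      fix K assume "K \<in> V // ?R\<^sup>*"
      then obtain x where x: "x \<in> V" "K = ?R\<^sup>* `` {x}" by (auto elim: quotientE)
      show "K \<in> insert (?c u \<union> ?c v) (V // R\<^sup>* - {?c u, ?c v})"
      proof (cases "x \<in> ?c u \<union> ?c v")
        case True then show ?thesis using x cls by auto
      next
        case False
        then have "K = ?c x" using x cls by auto
        moreover have "?c x \<noteq> ?c u" "?c x \<noteq> ?c v" using False unfolding ceq by (auto dest: s)
        ultimately show ?thesis using x by (auto simp: quotientI)
      qed
    next
      fix K assume K: "K \<in> insert (?c u \<union> ?c v) (V // R\<^sup>* - {?c u, ?c v})"
      show "K \<in> V // ?R\<^sup>*"
      proof (cases "K = ?c u \<union> ?c v")
        case True
        then have "K = ?R\<^sup>* `` {u}" using cls[of u] by auto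
        then show ?thesis using assms by (simp add: quotientI)
      next
        case F: False
        with K have "K \<in> V // R\<^sup>*" "K \<noteq> ?c u" "K \<noteq> ?c v" by simp_all
        then obtain x where x: "x \<in> V" "K = ?c x" "?c x \<noteq> ?c u" "?c x \<noteq> ?c v"
          by (metis quotientE)
        then have "x \<notin> ?c u \<union> ?c v" unfolding ceq by (auto dest: s)
        then have "K = ?R\<^sup>* `` {x}" using cls x by auto
        then show ?thesis using x by (simp add: quotientI)
      qed
    qed
    have "card (V // ?R\<^sup>*) = Suc (card (V // R\<^sup>* - {?c u, ?c v}))"
      unfolding eq using fin new by (subst card_insert_disjoint) auto
    also have "card (V // R\<^sup>* - {?c u, ?c v}) = card (V // R\<^sup>*) - 2"
      using uv fin by (subst card_Diff_subset) auto
    finally show ?thesis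
      using card_mono[of "V // R\<^sup>*" "{?c u, ?c v}"] uv fin False by (simp add: component_count_def)
  qed
qed

section \<open>Periodic nodes and the single cycle of each component\<close>

lemma fgraph_rtrancl_meet:
  assumes "(x, y) \<in> (fgraph V f)\<^sup>*"
  shows "\<exists>i j. (f ^^ i) x = (f ^^ j) y"
  using assms
proof (induction rule: rtrancl_induct)
  case base
  show ?case by blast
next
  case (step y z)
  then obtain i j where ij: "(f ^^ i) x = (f ^^ j) y" by blast
  \<comment> \<open>An edge followed forwards adds a step to the trajectory of \<open>x\<close>;
    followed backwards, it adds one to the trajectory of the end node.\<close>
  from step(2) consider "z = f y" | "y = f z"
    by (auto simp: fgraph_def doubleton_eq_iff)
  then show ?case
  proof cases
    case 1
    have "(f ^^ Suc i) x = (f ^^ j) z" using ij 1 by (simp add: funpow_swap1)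
    then show ?thesis by blast
  next
    case 2
    have "(f ^^ i) x = (f ^^ Suc j) z" using ij 2 by (simp add: funpow_swap1)
    then show ?thesis by blast
  qed
qed

lemma funpow_closed: "f ` X \<subseteq> X \<Longrightarrow> x \<in> X \<Longrightarrow> (f ^^ i) x \<in> X"
  by (induction i) auto

lemma orbit_closed: "f ` X \<subseteq> X \<Longrightarrow> x \<in> X \<Longrightarrow> orbit f x \<subseteq> X"
  by (auto simp: orbit_altdef funpow_closed)

text \<open>\<open>orbit\<close> contains only iterates with positive exponent, so
  \<open>s \<in> orbit f s\<close> says that \<open>s\<close> is periodic; applying \<open>f\<close>
  merely moves it along its cycle.\<close>

lemma orbit_funpow:
  assumes "s \<in> orbit f s"
  shows "orbit f ((f ^^ i) s) = orbit f s"
proof (induction i)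
  case (Suc i)
  have "(f ^^ i) s \<in> orbit f ((f ^^ i) s)"
    unfolding Suc using assms by (rule funpow_in_orbit)
  then show ?case using Suc by (simp add: self_in_orbit_step)
qed simp

text \<open>Pigeonhole: two iterates of \<open>x\<close> in the finite set coincide, and the earlier
  one then returns to itself.\<close>

lemma ex_periodic:
  assumes "finite V" "f ` V \<subseteq> V" "x \<in> V"
  shows "\<exists>i. (f ^^ i) x \<in> orbit f ((f ^^ i) x)"
proof -
  have "\<not> inj_on (\<lambda>i. (f ^^ i) x) UNIV"
  proof
    assume "inj_on (\<lambda>i. (f ^^ i) x) UNIV"
    moreover have "finite ((\<lambda>i. (f ^^ i) x) ` UNIV)"
      by (rule finite_subset[OF _ assms(1)]) (auto simp: funpow_closed[OF assms(2,3)])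
    ultimately show False using finite_imageD infinite_UNIV_nat by blast
  qed
  then obtain i j where "i < j" "(f ^^ i) x = (f ^^ j) x"
    unfolding inj_on_def by (metis linorder_neqE_nat)
  moreover have "(f ^^ (j - i)) ((f ^^ i) x) = (f ^^ (j - i + i)) x"
    by (simp only: funpow_add comp_apply)
  ultimately have "(f ^^ (j - i)) ((f ^^ i) x) = (f ^^ i) x" by simp
  with \<open>i < j\<close> show ?thesis unfolding orbit_altdef by (metis (mono_tags, lifting) mem_Collect_eq zero_less_diff)
qed

text \<open>Trajectories of connected nodes meet, and a periodic node keeps its orbit along its
  trajectory. So a component contains only one cycle.\<close>

lemma rtrancl_fgraph_orbit_eq:
  assumes "(x, y) \<in> (fgraph V f)\<^sup>*" "x \<in> orbit f x" "y \<in> orbit f y"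
  shows "orbit f x = orbit f y"
  using fgraph_rtrancl_meet[OF assms(1)] orbit_funpow[OF assms(2)] orbit_funpow[OF assms(3)] by metis

text \<open>\<open>f\<close> is injective on the finite set \<open>Y\<close>; extended by the
  identity it becomes a permutation, under which every node returns to itself.\<close>

lemma image_eq_imp_periodic:
  assumes "finite Y" "f ` Y = Y" "y \<in> Y"
  shows "y \<in> orbit f y"
proof -
  define g where "g x = (if x \<in> Y then f x else x)" for x
  have "bij_betw f Y Y"
    using assms by (simp add: bij_betw_def eq_card_imp_inj_on)
  then have "bij_betw g Y Y" by (rule bij_betw_cong[THEN iffD1, rotated]) (simp add: g_def)
  then have "g permutes Y" by (rule bij_imp_permutes) (simp add: g_def)
  then have "y \<in> orbit g y"
    using assms(1) by (intro permutation_self_in_orbit permutes_imp_permutation)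
  moreover have "orbit f y = orbit g y"
    by (rule orbit_cong0[OF assms(3)]) (use assms in \<open>auto simp: g_def\<close>)
  ultimately show ?thesis by simp
qed

lemma component_closed:
  assumes "f ` V \<subseteq> V" "K \<in> V // (fgraph V f)\<^sup>*"
  shows "K \<subseteq> V" "f ` K \<subseteq> K" "x \<in> K \<Longrightarrow> K = (fgraph V f)\<^sup>* `` {x}"
proof -
  obtain w where w: "w \<in> V" "K = (fgraph V f)\<^sup>* `` {w}"
    using assms(2) by (rule quotientE)
  have R: "fgraph V f \<subseteq> V \<times> V" using assms(1) by (rule fgraph_subset) simp
  show "K \<subseteq> V"
  proof
    fix y assume "y \<in> K"
    then have "(w, y) \<in> (fgraph V f)\<^sup>*" using w by simp
    then show "y \<in> V" by (rule rtrancl_closed) (use R w in auto)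
  qed
  then have "(y, f y) \<in> fgraph V f" if "y \<in> K" for y
    using that by (auto simp: fgraph_def)
  then show "f ` K \<subseteq> K" unfolding w(2) by (auto intro: rtrancl.rtrancl_into_rtrancl)
  show "K = (fgraph V f)\<^sup>* `` {x}" if "x \<in> K"
    using that sym_star_image_eq[OF sym_fgraph, of w x] w(2) by simp
qed

lemma component_periodic:
  assumes "finite V" "f ` V \<subseteq> V" "K \<in> V // (fgraph V f)\<^sup>*"
  shows "\<exists>x\<in>K. x \<in> orbit f x"
proof -
  obtain w where w: "w \<in> V" "K = (fgraph V f)\<^sup>* `` {w}"
    using assms(3) by (rule quotientE)
  then have "w \<in> K" by simp
  then show ?thesis
    using ex_periodic[OF assms(1,2) w(1)] component_closed(2)[OF assms(2,3)] funpow_closed by metis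
qed

text \<open>The sets that \<open>f\<close> maps onto themselves are the unions of cycles. As every
  component has exactly one cycle, each component is in or out independently: \<open>F\<close> lists
  the components that \<open>Y\<close> meets, and \<open>G\<close> recovers the cycles of the chosen
  components.\<close>

lemma card_fixed_subsets:
  assumes "finite V" "f ` V \<subseteq> V"
  shows "card {Y. Y \<subseteq> V \<and> f ` Y = Y} = 2 ^ component_count V (fgraph V f)"
proof -
  let ?Q = "V // (fgraph V f)\<^sup>*"
  define F where "F Y = {K \<in> ?Q. K \<inter> Y \<noteq> {}}" for Y
  define G where "G \<K> = {x \<in> \<Union>\<K>. x \<in> orbit f x}" for \<K>
  have cl: "(fgraph V f)\<^sup>* `` {x} \<in> ?Q" if "x \<in> V" for x using that by (rule quotientI)
  have "bij_betw F {Y. Y \<subseteq> V \<and> f ` Y = Y} (Pow ?Q)"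
  proof (rule bij_betw_byWitness[where f' = G]; intro ballI subsetI)
    fix Y assume "Y \<in> {Y. Y \<subseteq> V \<and> f ` Y = Y}"
    then have Y: "Y \<subseteq> V" "f ` Y = Y" by auto
    have finY: "finite Y" using Y(1) assms(1) by (rule finite_subset)
    show "G (F Y) = Y"
    proof (intro equalityI subsetI)
      fix x assume "x \<in> G (F Y)"
      then obtain K y where K: "K \<in> ?Q" "y \<in> K" "y \<in> Y" "x \<in> K" and x: "x \<in> orbit f x"
        by (auto simp: F_def G_def)
      have "(x, y) \<in> (fgraph V f)\<^sup>*"
        using component_closed(3)[OF assms(2) K(1) K(4)] K(2) by blast
      then have "orbit f x = orbit f y"
        by (rule rtrancl_fgraph_orbit_eq[OF _ x image_eq_imp_periodic[OF finY Y(2) K(3)]])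
      then show "x \<in> Y" using x orbit_closed[of f Y y] Y K by auto
    next
      fix y assume y: "y \<in> Y"
      have "(fgraph V f)\<^sup>* `` {y} \<in> F Y" using cl[of y] y Y unfolding F_def by auto
      then show "y \<in> G (F Y)"
        using image_eq_imp_periodic[OF finY Y(2) y] unfolding G_def by auto
    qed
  next
    fix \<K> assume "\<K> \<in> Pow ?Q"
    then have \<K>: "\<K> \<subseteq> ?Q" by simp
    show "F (G \<K>) = \<K>"
    proof (intro equalityI subsetI)
      fix K assume "K \<in> F (G \<K>)"
      then obtain x K' where x: "K \<in> ?Q" "x \<in> K" "x \<in> K'" "K' \<in> \<K>"
        by (auto simp: F_def G_def)
      then have "K = K'" using component_closed(3)[OF assms(2)] \<K> by blast
      then show "K \<in> \<K>" using x by simp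
    next
      fix K assume K: "K \<in> \<K>"
      then obtain x where "x \<in> K" "x \<in> orbit f x"
        using component_periodic[OF assms] \<K> by blast
      then show "K \<in> F (G \<K>)" using K \<K> unfolding F_def G_def by auto
    qed
  next
    fix X assume "X \<in> F ` {Y. Y \<subseteq> V \<and> f ` Y = Y}"
    then show "X \<in> Pow ?Q" by (auto simp: F_def)
  next
    fix Y assume "Y \<in> G ` Pow ?Q"
    then obtain \<K> where \<K>: "\<K> \<subseteq> ?Q" "Y = G \<K>" by auto
    have step: "f x \<in> Y" if "x \<in> Y" for x
    proof -
      have "x \<in> \<Union>\<K>" and per: "x \<in> orbit f x" using that \<K>(2) by (simp_all add: G_def)
      then obtain K where K: "x \<in> K" "K \<in> \<K>" by blast
      then have "f x \<in> K" using component_closed(2)[OF assms(2)] \<K>(1) by blast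
      moreover have "f x \<in> orbit f (f x)"
        using per by (simp add: self_in_orbit_step orbit.base)
      ultimately show ?thesis using K(2) \<K>(2) by (auto simp: G_def)
    qed
    have "x \<in> f ` Y" if "x \<in> Y" for x
    proof -
      have "x \<in> orbit f x" using that \<K>(2) by (auto simp: G_def)
      then obtain n where n: "n > 0" "x = (f ^^ n) x" by (auto simp: orbit_altdef)
      \<comment> \<open>The predecessor of \<open>x\<close> on its cycle, one step before the
        return, is the preimage wanted.\<close>
      then have "x = f ((f ^^ (n - 1)) x)" by (cases n) auto
      moreover have "(f ^^ (n - 1)) x \<in> Y" by (rule funpow_closed) (use step that in auto)
      ultimately show ?thesis by blast
    qed
    with step have "f ` Y = Y" by blast
    moreover have "Y \<subseteq> V" using \<K> component_closed(1)[OF assms(2)] by (auto simp: G_def)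
    ultimately show "Y \<in> {Y. Y \<subseteq> V \<and> f ` Y = Y}" by simp
  qed
  then have "card {Y. Y \<subseteq> V \<and> f ` Y = Y} = card (Pow ?Q)" by (rule bij_betw_same_card)
  also have "\<dots> = 2 ^ component_count V (fgraph V f)"
    using assms(1) by (simp add: card_Pow component_count_def quotient_def)
  finally show ?thesis .
qed

section \<open>Pseudoforests and orientations\<close>

text \<open>\<open>e\<close> gives every node \<open>v\<close> its own edge, leading to
  \<open>f v\<close>. A cycle has as many edges as nodes, so its edges are those owned by its nodes;
  hence \<open>f\<close> stays on the cycle, and an orbit inside it has to exhaust it.\<close>

lemma cycle_subset_orbit:
  assumes fin: "finite (nodes G)" and f: "f ` nodes G \<subseteq> nodes G"
    and e: "bij_betw e (nodes G) (edges G)" and ends: "\<And>v. v \<in> nodes G \<Longrightarrow> ends G (e v) = {v, f v}"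
    and C: "is_cycle G C"
  shows "\<exists>x\<in>nodes G. x \<in> orbit f x \<and> C = e ` orbit f x"
proof -
  obtain vs es where c: "es \<noteq> []" "length vs = length es" "distinct vs" "distinct es"
      "set vs \<subseteq> nodes G" "set es \<subseteq> edges G" "C = set es"
      "\<And>i. i < length es \<Longrightarrow> ends G (es ! i) = {vs ! i, vs ! (Suc i mod length es)}"
    using C unfolding is_cycle_def by blast
  define k where "k = length es"
  have k: "k > 0" "length vs = k" using c by (auto simp: k_def)
  define T where "T = {v \<in> nodes G. e v \<in> set es}"
  have inj: "inj_on e (nodes G)" and surj: "e ` nodes G = edges G"
    using e by (auto simp: bij_betw_def)
  have T: "e ` T = set es" using c(6) surj unfolding T_def by auto
  have TX: "v \<in> set vs \<and> f v \<in> set vs" if "v \<in> T" for v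
  proof -
    have "e v \<in> set es" using that by (simp add: T_def)
    then obtain i where "i < k" "es ! i = e v" unfolding k_def in_set_conv_nth by blast
    then have "{v, f v} = {vs ! i, vs ! (Suc i mod k)}"
      using c(8)[of i] ends[of v] that by (auto simp: T_def k_def)
    moreover have "vs ! i \<in> set vs" "vs ! (Suc i mod k) \<in> set vs"
      using \<open>i < k\<close> k by (auto intro: nth_mem)
    ultimately show ?thesis by (auto simp: doubleton_eq_iff)
  qed
  \<comment> \<open>The owners of the cycle's edges lie on the cycle and are as many as its nodes,
    which forces equality.\<close>
  have "card T = card (e ` T)"
    using inj by (intro card_image[symmetric] inj_on_subset[OF inj]) (auto simp: T_def)
  also have "\<dots> = card (set vs)" using c by (simp add: T distinct_card)
  finally have TX_eq: "T = set vs" using TX by (intro card_subset_eq) auto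
  have fX: "f ` set vs \<subseteq> set vs" using TX TX_eq by auto
  obtain x where x: "x \<in> set vs" "x \<in> orbit f x"
  proof -
    have "vs ! 0 \<in> set vs" using k by (intro nth_mem) auto
    from ex_periodic[OF _ fX this] funpow_closed[OF fX this] show ?thesis using that by auto
  qed
  define Y where "Y = orbit f x"
  have Y: "Y \<subseteq> set vs" "x \<in> Y" "\<And>y. y \<in> Y \<Longrightarrow> f y \<in> Y"
    using orbit_closed[OF fX x(1)] x(2) by (auto simp: Y_def intro: orbit.step)
  define I where "I = {i. i < k \<and> vs ! i \<in> Y}"
  define I' where "I' = {i \<in> I. Suc i mod k \<in> I}"
  have finI: "finite I" "finite I'" by (auto simp: I_def I'_def)
  text \<open>The \<open>card Y\<close> edges leaving \<open>Y\<close> have both ends in \<open>Y\<close>, so no edge of the cycle leads out of \<open>Y\<close>.\<close>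
  have "e ` Y \<subseteq> (!) es ` I'"
  proof
    fix a assume "a \<in> e ` Y"
    then obtain y where y: "y \<in> Y" "a = e y" by auto
    then have "e y \<in> set es" using Y(1) T TX_eq by auto
    then obtain i where i: "i < k" "es ! i = e y" unfolding k_def in_set_conv_nth by blast
    have "{y, f y} = {vs ! i, vs ! (Suc i mod k)}"
      using c(8)[of i] i ends[of y] y Y(1) c(5) by (auto simp: k_def)
    then have "{vs ! i, vs ! (Suc i mod k)} \<subseteq> Y" using y Y(3)[of y] by auto
    then have "i \<in> I'" using i k by (auto simp: I_def I'_def)
    then show "a \<in> (!) es ` I'" using i y by force
  qed
  then have "card (e ` Y) \<le> card I'"
    using finI by (meson card_image_le card_mono finite_imageI order_trans)
  moreover have "card (e ` Y) = card Y"
    using Y(1) c(5) by (intro card_image inj_on_subset[OF inj]) auto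
  moreover have "card I = card Y"
  proof -
    have "(!) vs ` I = Y" using Y(1) k by (force simp: I_def in_set_conv_nth image_iff)
    moreover have "inj_on ((!) vs) I" using c(3) k by (auto simp: I_def inj_on_def nth_eq_iff_index_eq)
    ultimately show ?thesis using card_image by metis
  qed
  ultimately have II: "I' = I" using finI by (intro card_seteq) (auto simp: I'_def)
  obtain i0 where i0: "i0 \<in> I" using Y(1,2) k by (auto simp: I_def in_set_conv_nth subset_iff)
  have step: "(i0 + m) mod k \<in> I" for m
  proof (induction m)
    case 0 then show ?case using i0 by (simp add: I_def)
  next
    case (Suc m)
    then have "Suc ((i0 + m) mod k) mod k \<in> I" using II by (auto simp: I'_def)
    then show ?case by (simp add: mod_Suc_eq)
  qed
  \<comment> \<open>Closure of \<open>I\<close> under the cyclic successor reaches every position.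
    Adding \<open>k\<close> first keeps the subtraction of \<open>i0\<close> exact.\<close>
  have "i \<in> I" if "i < k" for i
  proof -
    have "i0 < k" using i0 by (simp add: I_def)
    then have "(i0 + (i + k - i0)) mod k = i" using that by simp
    then show ?thesis using step by metis
  qed
  then have "set vs \<subseteq> Y" using k by (auto simp: in_set_conv_nth I_def)
  with Y(1) have "Y = set vs" by simp
  then have "C = e ` orbit f x" using c(7) T TX_eq by (simp add: Y_def)
  then show ?thesis using x c(5) by blast
qed

text \<open>The iterates of \<open>x\<close> before its first return are distinct, and injectivity
  of \<open>e\<close> makes their edges distinct. Periods 1 and 2 give loops and parallel
  edges.\<close>

lemma orbit_is_cycle:
  assumes f: "f ` nodes G \<subseteq> nodes G"
    and e: "bij_betw e (nodes G) (edges G)" and ends: "\<And>v. v \<in> nodes G \<Longrightarrow> ends G (e v) = {v, f v}"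
    and x: "x \<in> nodes G" "x \<in> orbit f x"
  shows "is_cycle G (e ` orbit f x)"
proof -
  define p where "p = funpow_dist1 f x x"
  have p: "p > 0" "(f ^^ p) x = x" using funpow_dist1_prop[OF x(2)] by (simp_all add: p_def)
  have neq: "(f ^^ i) x \<noteq> (f ^^ j) x" if "i < p" "j < p" "i \<noteq> j" for i j
    using funpow_neq_less_funpow_dist1[OF x(2), folded p_def, OF that] .
  define vs where "vs = map (\<lambda>i. (f ^^ i) x) [0..<p]"
  have len: "length vs = p" by (simp add: vs_def)
  have nth: "vs ! i = (f ^^ i) x" if "i < p" for i using that by (simp add: vs_def)
  have set: "set vs = orbit f x"
    unfolding orbit_altdef_bounded[OF p(2,1)] by (auto simp: vs_def)
  have dist: "distinct vs"
    unfolding distinct_conv_nth len using neq by (auto simp: nth)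
  have inj: "inj_on e (nodes G)" and surj: "e ` nodes G = edges G"
    using e by (auto simp: bij_betw_def)
  have sub: "set vs \<subseteq> nodes G" unfolding set using orbit_closed[OF f x(1)] .
  have "ends G (map e vs ! i) = {vs ! i, vs ! (Suc i mod p)}" if "i < p" for i
  proof -
    have "vs ! i \<in> nodes G" using that len sub nth_mem by blast
    then have "ends G (map e vs ! i) = {vs ! i, f (vs ! i)}" using that len ends by simp
    also have "f (vs ! i) = (f ^^ Suc i) x" using that nth by simp
    also have "\<dots> = vs ! (Suc i mod p)"
    proof (cases "Suc i = p")
      \<comment> \<open>At the last position the index wraps around to 0, in agreement with the
        return of \<open>x\<close> to itself after \<open>p\<close> steps.\<close>
      case True
      then show ?thesis using p nth[of 0] by (simp del: funpow.simps(2))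
    next
      case False
      then show ?thesis using that nth[of "Suc i"] by simp
    qed
    finally show ?thesis .
  qed
  then show ?thesis
    unfolding is_cycle_def using p(1) dist sub inj surj len
    by (intro exI[of _ vs] exI[of _ "map e vs"] conjI)
       (auto simp: distinct_map set[symmetric] intro: inj_on_subset simp flip: surj)
qed

lemma adjacency_functional:
  assumes "bij_betw e (nodes G) (edges G)" "\<And>v. v \<in> nodes G \<Longrightarrow> ends G (e v) = {v, f v}"
  shows "adjacency G = fgraph (nodes G) f"
proof -
  have "edges G = e ` nodes G" using assms(1) by (auto simp: bij_betw_def)
  then show ?thesis using assms(2) by (auto simp: adjacency_def fgraph_def)
qed

text \<open>Each component has a periodic node, whose orbit yields a cycle. Any cycle inside the
  component comes from some periodic node there, and connected periodic nodes share their
  orbit.\<close>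

lemma pseudoforest_functional:
  assumes fin: "finite (nodes G)" and f: "f ` nodes G \<subseteq> nodes G"
    and e: "bij_betw e (nodes G) (edges G)" and ends: "\<And>v. v \<in> nodes G \<Longrightarrow> ends G (e v) = {v, f v}"
  shows "pseudoforest G"
proof -
  have adj: "adjacency G = fgraph (nodes G) f"
    using adjacency_functional[OF e] ends by blast
  have uniq: "\<exists>!C. is_cycle G C \<and> (\<Union>a\<in>C. ends G a) \<subseteq> K" if K: "K \<in> nodes G // (fgraph (nodes G) f)\<^sup>*" for K
  proof -
    note cl = component_closed[OF f K]
    obtain x where x: "x \<in> K" "x \<in> orbit f x" using component_periodic[OF fin f K] by blast
    have xV: "x \<in> nodes G" using x cl by blast
    have ends_orbit: "(\<Union>a\<in>e ` orbit f y. ends G a) = orbit f y" if "y \<in> nodes G" for y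
    proof -
      have "orbit f y \<subseteq> nodes G" using orbit_closed[OF f that] .
      then have "(\<Union>a\<in>e ` orbit f y. ends G a) = (\<Union>v\<in>orbit f y. {v, f v})"
        using ends by (auto simp: subset_iff)
      also have "\<dots> = orbit f y" by (auto intro: orbit.step)
      finally show ?thesis .
    qed
    show ?thesis
    proof (rule ex1I)
      show "is_cycle G (e ` orbit f x) \<and> (\<Union>a\<in>e ` orbit f x. ends G a) \<subseteq> K"
        using orbit_is_cycle[OF f e ends xV x(2)] orbit_closed[OF cl(2) x(1)] ends_orbit[OF xV] by simp
    next
      fix C assume C: "is_cycle G C \<and> (\<Union>a\<in>C. ends G a) \<subseteq> K"
      then obtain y where y: "y \<in> nodes G" "y \<in> orbit f y" "C = e ` orbit f y"
        using cycle_subset_orbit[OF fin f e ends] by blast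
      then have "y \<in> K" using C ends_orbit by auto
      then have "(y, x) \<in> (fgraph (nodes G) f)\<^sup>*" using cl(3)[of y] x(1) by blast
      then have "orbit f y = orbit f x" by (rule rtrancl_fgraph_orbit_eq[OF _ y(2) x(2)])
      then show "C = e ` orbit f x" using y by simp
    qed
  qed
  show ?thesis
    unfolding pseudoforest_def multigraph_components_def adj by (intro ballI uniq)
qed

section \<open>Selecting for each node of a pseudoforest an incident edge of its own\<close>

lemma rtrancl_exit:
  assumes "(x, y) \<in> R\<^sup>*" "x \<in> U" "y \<notin> U"
  obtains u w where "u \<in> U" "w \<notin> U" "(u, w) \<in> R"
  using rtrancl_closed[OF assms(1), of U] assms(2,3) by blast

text \<open>Going around the cycle, each node \<open>vs ! i\<close> takes the edge
  \<open>es ! i\<close> on which it is left.\<close>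

lemma cycle_selector:
  assumes "is_cycle G C"
  shows "\<exists>X m. X \<noteq> {} \<and> X \<subseteq> nodes G \<and> X = (\<Union>a\<in>C. ends G a) \<and> inj_on m X \<and> m ` X = C \<and> C \<subseteq> edges G \<and>
     (\<forall>v\<in>X. v \<in> ends G (m v))"
proof -
  obtain vs es where c: "es \<noteq> []" "length vs = length es" "distinct vs" "distinct es"
      "set vs \<subseteq> nodes G" "set es \<subseteq> edges G" "C = set es"
      "\<And>i. i < length es \<Longrightarrow> ends G (es ! i) = {vs ! i, vs ! (Suc i mod length es)}"
    using assms unfolding is_cycle_def by blast
  define m where "m v = the (map_of (zip vs es) v)" for v
  have m: "m (vs ! i) = es ! i" if "i < length es" for i
    using map_of_zip_nth[OF c(2,3) that] by (simp add: m_def)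
  have mset: "\<exists>i<length es. v = vs ! i \<and> m v = es ! i" if "v \<in> set vs" for v
    using that m c(2) by (auto simp: in_set_conv_nth)
  have injm: "inj_on m (set vs)"
  proof (rule inj_onI)
    fix v w assume "v \<in> set vs" "w \<in> set vs" and eq: "m v = m w"
    then obtain i j where "i < length es" "v = vs ! i" "m v = es ! i" "j < length es" "w = vs ! j" "m w = es ! j"
      using mset by meson
    then show "v = w" using eq nth_eq_iff_index_eq[OF c(4)] by auto
  qed
  have imm: "m ` set vs = C"
  proof
    show "m ` set vs \<subseteq> C" using mset c(7) by fastforce
    show "C \<subseteq> m ` set vs"
    proof
      fix a assume "a \<in> C"
      then obtain i where "i < length es" "a = es ! i" using c(7) by (auto simp: in_set_conv_nth)
      then have "a = m (vs ! i)" "vs ! i \<in> set vs" using m c(2) by auto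
      then show "a \<in> m ` set vs" by blast
    qed
  qed
  have inc: "v \<in> ends G (m v)" if "v \<in> set vs" for v
    using mset[OF that] c(8) by fastforce
  have un: "set vs = (\<Union>a\<in>C. ends G a)"
  proof
    show "set vs \<subseteq> (\<Union>a\<in>C. ends G a)" using inc imm by blast
    have "ends G a \<subseteq> set vs" if a: "a \<in> C" for a
    proof -
      obtain i where i: "i < length es" "a = es ! i" using c(7) a by (auto simp: in_set_conv_nth)
      have "Suc i mod length es < length es" using c(1) by simp
      then have "vs ! i \<in> set vs" "vs ! (Suc i mod length es) \<in> set vs"
        using i c(2) by (metis nth_mem)+
      then show ?thesis using c(8)[OF i(1)] i(2) by simp
    qed
    then show "(\<Union>a\<in>C. ends G a) \<subseteq> set vs" by blast
  qed
  have "set vs \<noteq> {}" using c by auto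
  then show ?thesis
    using injm imm inc un c(5-7) by (intro exI[of _ "set vs"] exI[of _ m] conjI ballI) simp_all
qed

text \<open>Take a maximal node set \<open>U\<close> with a selection whose edges stay inside
  \<open>U\<close>. If a node \<open>w\<close> is missing, \<open>U\<close> can grow: by the cycle
  in the component of \<open>w\<close> if that component avoids \<open>U\<close>, and otherwise by a
  node outside \<open>U\<close> that is adjacent to \<open>U\<close>.\<close>

lemma pseudoforest_selector:
  assumes fin: "finite (nodes G)" and sub: "\<And>a. a \<in> edges G \<Longrightarrow> ends G a \<subseteq> nodes G"
    and pf: "pseudoforest G"
  shows "\<exists>m. inj_on m (nodes G) \<and> m ` nodes G \<subseteq> edges G \<and> (\<forall>v\<in>nodes G. v \<in> ends G (m v))"
proof -
  \<comment> \<open>Selected edges are confined to \<open>U\<close>, so every edge with an end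
    outside \<open>U\<close> is still free.\<close>
  define good where "good U m \<longleftrightarrow> inj_on m U \<and> (\<forall>v\<in>U. m v \<in> edges G \<and> v \<in> ends G (m v) \<and> ends G (m v) \<subseteq> U)"
    for U m
  define \<U> where "\<U> = {U. U \<subseteq> nodes G \<and> (\<exists>m. good U m)}"
  have "finite \<U>" unfolding \<U>_def using fin by auto
  moreover have "{} \<in> \<U>" by (auto simp: \<U>_def good_def)
  ultimately obtain U where U: "U \<in> \<U>" and max: "\<And>U'. U' \<in> \<U> \<Longrightarrow> U \<subseteq> U' \<Longrightarrow> U' = U"
    using finite_has_maximal[of \<U>] by blast
  obtain m where m: "good U m" and UV: "U \<subseteq> nodes G" using U by (auto simp: \<U>_def)
  have minj: "inj_on m U" and mE: "\<And>v. v \<in> U \<Longrightarrow> m v \<in> edges G" and mv: "\<And>v. v \<in> U \<Longrightarrow> v \<in> ends G (m v)"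
    and mU: "\<And>v. v \<in> U \<Longrightarrow> ends G (m v) \<subseteq> U"
    using m by (auto simp: good_def)
  have "U = nodes G"
  proof (rule ccontr)
    assume "U \<noteq> nodes G"
    then obtain w where w: "w \<in> nodes G" "w \<notin> U" using UV by blast
    define K where "K = (adjacency G)\<^sup>* `` {w}"
    have K: "K \<in> multigraph_components G"
      using w by (auto simp: K_def multigraph_components_def intro: quotientI)
    then obtain C where C: "is_cycle G C" "(\<Union>a\<in>C. ends G a) \<subseteq> K"
      using pf unfolding pseudoforest_def by blast
    obtain X m0 where X: "X \<noteq> {}" "X \<subseteq> nodes G" "X = (\<Union>a\<in>C. ends G a)" "inj_on m0 X" "m0 ` X = C"
        "C \<subseteq> edges G" and m0: "\<And>v. v \<in> X \<Longrightarrow> v \<in> ends G (m0 v)"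
      using cycle_selector[OF C(1)] by metis
    show False
    proof (cases "K \<inter> U = {}")
      case True
      then have XU: "X \<inter> U = {}" using X(3) C(2) by blast
      define m' where "m' v = (if v \<in> U then m v else m0 v)" for v
      have m'X: "m' v = m0 v" if "v \<in> X" for v using that XU by (auto simp: m'_def)
      have m'U: "m' v = m v" if "v \<in> U" for v using that by (simp add: m'_def)
      \<comment> \<open>Edges selected by \<open>m\<close> have no end in \<open>X\<close>, while
        \<open>m0 x\<close> contains \<open>x\<close>.\<close>
      have ne: "m v \<noteq> m0 x" if "v \<in> U" "x \<in> X" for v x
        using mU[OF that(1)] m0[OF that(2)] XU that by auto
      have "inj_on m' (U \<union> X)"
      proof (rule inj_onI)
        fix x y assume "x \<in> U \<union> X" "y \<in> U \<union> X" "m' x = m' y"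
        then show "x = y"
          using m'X m'U ne minj X(4) by (elim UnE) (metis inj_onD)+
      qed
      moreover have "m' v \<in> edges G \<and> v \<in> ends G (m' v) \<and> ends G (m' v) \<subseteq> U \<union> X" if "v \<in> U \<union> X" for v
        using that
      proof
        assume "v \<in> U" then show ?thesis using m'U[of v] mE[of v] mv[of v] mU[of v] by auto
      next
        assume v: "v \<in> X"
        then have "m0 v \<in> C" using X(5) by blast
        then show ?thesis using m'X[OF v] m0[OF v] X(3,6) by auto
      qed
      ultimately have "U \<union> X \<in> \<U>" using UV X(2) unfolding \<U>_def good_def by blast
      then have "U \<union> X = U" by (rule max) simp
      then show False using X(1) XU by blast
    next
      case False
      then obtain u0 where "u0 \<in> U" "(w, u0) \<in> (adjacency G)\<^sup>*" by (auto simp: K_def)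
      \<comment> \<open>A path from \<open>w\<close> to \<open>u0\<close> enters \<open>U\<close>
        along some edge; this edge is given to its outer end \<open>v'\<close>.\<close>
      then obtain v' u where vu: "v' \<in> - U" "u \<notin> - U" "(v', u) \<in> adjacency G"
        using w by (elim rtrancl_exit[where U = "- U"]) auto
      then obtain a where a: "a \<in> edges G" "ends G a = {v', u}" by (auto simp: adjacency_def)
      have v'V: "v' \<in> nodes G" using sub[OF a(1)] a(2) by simp
      have anew: "m v \<noteq> a" if "v \<in> U" for v using mU[OF that] a(2) vu by auto
      have "inj_on (m(v' := a)) (insert v' U)"
        using minj vu(1) anew by (auto simp: inj_on_def)
      moreover have "\<forall>v\<in>insert v' U. (m(v' := a)) v \<in> edges G \<and> v \<in> ends G ((m(v' := a)) v) \<and>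
          ends G ((m(v' := a)) v) \<subseteq> insert v' U"
        using mE mv mU a vu by auto
      ultimately have "insert v' U \<in> \<U>" using UV v'V unfolding \<U>_def good_def by blast
      then have "insert v' U = U" by (rule max) auto
      then show False using vu by blast
    qed
  qed
  then show ?thesis using minj mE mv by blast
qed

text \<open>\<open>q (x, b x)\<close> is the tail of edge \<open>x\<close>; bijectivity makes every
  node the tail of exactly one edge. Since \<open>b\<close> chooses positions and not nodes, a loop
  also has two orientations, which keeps the factor 2 per cycle uniform.\<close>

definition orientations :: "('a \<times> nat \<Rightarrow> nat) \<Rightarrow> 'a set \<Rightarrow> nat set \<Rightarrow> ('a \<Rightarrow> nat) set" where
  "orientations q S V = {b \<in> S \<rightarrow>\<^sub>E {0, 1}. bij_betw (\<lambda>x. q (x, b x)) S V}"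

text \<open>This is the effect of reversing the edges owned by \<open>Y\<close>: their tails move
  from \<open>v\<close> to \<open>f v\<close>. The complement of \<open>Y\<close> is fixed and
  covers itself, so bijectivity leaves exactly \<open>Y\<close> as the image of
  \<open>Y\<close>.\<close>

lemma bij_betw_if_iff:
  assumes "finite V" "f ` V \<subseteq> V" "Y \<subseteq> V"
  shows "bij_betw (\<lambda>v. if v \<in> Y then f v else v) V V \<longleftrightarrow> f ` Y = Y"
proof
  let ?g = "\<lambda>v. if v \<in> Y then f v else v"
  assume bij: "bij_betw ?g V V"
  have "f ` Y = ?g ` (V - (V - Y))" using assms(3) by auto
  also have "\<dots> = ?g ` V - ?g ` (V - Y)"
    using bij by (intro inj_on_image_set_diff[of _ V]) (auto simp: bij_betw_def)
  also have "?g ` (V - Y) = V - Y" by auto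
  also have "?g ` V = V" using bij by (simp add: bij_betw_def)
  finally show "f ` Y = Y" using assms(3) by auto
next
  let ?g = "\<lambda>v. if v \<in> Y then f v else v"
  assume "f ` Y = Y"
  moreover have "?g ` V = ?g ` Y \<union> ?g ` (V - Y)" using assms(3) by blast
  moreover have "?g ` Y = f ` Y" "?g ` (V - Y) = V - Y" by auto
  ultimately have "?g ` V = V" using assms(3) by auto
  then show "bij_betw ?g V V"
    using assms(1) by (simp add: bij_betw_def eq_card_imp_inj_on)
qed

section \<open>Oriented hash graphs as graphs of functions\<close>

context
  fixes n :: nat and S :: "'a set" and V :: "nat set" and q :: "'a \<times> nat \<Rightarrow> nat"
  assumes q: "q \<in> S \<times> {0, 1} \<rightarrow> {1..n}" and V: "V = {1..n}"
begin

lemma hash_in: "x \<in> S \<Longrightarrow> c \<in> {0, 1} \<Longrightarrow> q (x, c) \<in> V"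
  using q V by (auto simp: Pi_def)

text \<open>The edge with tail \<open>v\<close>; it serves as \<open>e\<close> in the lemmas on
  functional graphs.\<close>

definition owner :: "('a \<Rightarrow> nat) \<Rightarrow> nat \<Rightarrow> 'a" where
  "owner b = inv_into S (\<lambda>x. q (x, b x))"

text \<open>The head of the edge with tail \<open>v\<close>, as \<open>1 - b\<close> switches to the
  other end. The hash graph is the graph of this function.\<close>

definition target :: "('a \<Rightarrow> nat) \<Rightarrow> nat \<Rightarrow> nat" where
  "target b v = q (owner b v, 1 - b (owner b v))"

context
  fixes b :: "'a \<Rightarrow> nat"
  assumes b: "b \<in> orientations q S V"
begin

lemma orientation_in: "x \<in> S \<Longrightarrow> b x \<in> {0, 1}"
  and orientation_bij: "bij_betw (\<lambda>x. q (x, b x)) S V"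
  using b by (auto simp: orientations_def)

lemma owner_bij: "bij_betw (owner b) V S"
  unfolding owner_def by (rule bij_betw_inv_into[OF orientation_bij])

lemma owner_in: "v \<in> V \<Longrightarrow> owner b v \<in> S"
  using owner_bij by (auto simp: bij_betw_def)

lemma hash_owner: "v \<in> V \<Longrightarrow> q (owner b v, b (owner b v)) = v"
  unfolding owner_def using bij_betw_inv_into_right[OF orientation_bij] .

lemma owner_hash: "x \<in> S \<Longrightarrow> owner b (q (x, b x)) = x"
  unfolding owner_def using bij_betw_inv_into_left[OF orientation_bij] .

lemma target_image: "target b ` V \<subseteq> V"
proof -
  have "target b v \<in> V" if "v \<in> V" for v
    unfolding target_def using owner_in[OF that] by (intro hash_in) auto
  then show ?thesis by blast
qed

lemma ends_owner:
  assumes "v \<in> nodes (hash_graph n S q)"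
  shows "ends (hash_graph n S q) (owner b v) = {v, target b v}"
proof -
  have v: "v \<in> V" using assms by (simp add: hash_graph_def V)
  have "b (owner b v) = 0 \<or> b (owner b v) = 1" using orientation_in[OF owner_in[OF v]] by simp
  then show ?thesis
    using hash_owner[OF v] by (auto simp: hash_graph_def target_def)
qed

lemma hash_graph_functional:
  "finite (nodes (hash_graph n S q))"
  "target b ` nodes (hash_graph n S q) \<subseteq> nodes (hash_graph n S q)"
  "bij_betw (owner b) (nodes (hash_graph n S q)) (edges (hash_graph n S q))"
  using target_image owner_bij by (simp_all add: hash_graph_def V)

lemma adjacency_orientation: "adjacency (hash_graph n S q) = fgraph V (target b)"
  using adjacency_functional[OF hash_graph_functional(3) ends_owner] by (simp add: hash_graph_def V)

lemma pseudoforest_orientation: "pseudoforest (hash_graph n S q)"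
  using pseudoforest_functional[OF hash_graph_functional ends_owner] .

text \<open>Relative to \<open>b\<close>, an orientation \<open>c\<close> is determined by the set
  \<open>?F c\<close> of nodes whose edges it reverses. A set may be reversed iff
  \<open>target b\<close> maps it onto itself, so \<open>card_fixed_subsets\<close> applies.\<close>

lemma card_orientations:
  "card (orientations q S V) = 2 ^ card (multigraph_components (hash_graph n S q))"
proof -
  let ?F = "\<lambda>c. {v \<in> V. c (owner b v) \<noteq> b (owner b v)}"
  let ?G = "\<lambda>Y. \<lambda>x\<in>S. if q (x, b x) \<in> Y then 1 - b x else b x"
  have finV: "finite V" by (simp add: V)
  have flip: "bij_betw (\<lambda>x. q (x, c x)) S V \<longleftrightarrow> target b ` ?F c = ?F c" if c: "c \<in> S \<rightarrow> {0, 1}" for c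
  proof -
    \<comment> \<open>Indexing edges by their tails under \<open>b\<close> turns the tail map of
      \<open>c\<close> into a self-map of \<open>V\<close>.\<close>
    have "bij_betw (\<lambda>x. q (x, c x)) S V \<longleftrightarrow> bij_betw ((\<lambda>x. q (x, c x)) \<circ> owner b) V V"
      using bij_betw_comp_iff[OF owner_bij] .
    also have "\<dots> \<longleftrightarrow> bij_betw (\<lambda>v. if v \<in> ?F c then target b v else v) V V"
    proof (rule bij_betw_cong)
      fix v assume v: "v \<in> V"
      have "c (owner b v) \<in> {0, 1}" "b (owner b v) \<in> {0, 1}"
        using c orientation_in owner_in[OF v] by (auto simp: Pi_def)
      then show "((\<lambda>x. q (x, c x)) \<circ> owner b) v = (if v \<in> ?F c then target b v else v)"
        using v hash_owner[OF v] by (auto simp: target_def)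
    qed
    also have "\<dots> \<longleftrightarrow> target b ` ?F c = ?F c"
      by (rule bij_betw_if_iff[OF finV target_image]) auto
    finally show ?thesis .
  qed
  have GF: "?F (?G Y) = Y" if Y: "Y \<subseteq> V" for Y
  proof (intro set_eqI)
    fix v
    show "v \<in> ?F (?G Y) \<longleftrightarrow> v \<in> Y"
    proof (cases "v \<in> V")
      case True
      then show ?thesis
        using hash_owner[OF True] owner_in[OF True] orientation_in[OF owner_in[OF True]] by auto
    qed (use Y in auto)
  qed
  have G01: "?G Y \<in> S \<rightarrow>\<^sub>E {0, 1}" for Y
  proof -
    have "(if q (x, b x) \<in> Y then 1 - b x else b x) \<in> {0, 1}" if "x \<in> S" for x
      using orientation_in[OF that] by auto
    then show ?thesis by (simp only: restrict_PiE_iff) blast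
  qed
  have "bij_betw ?F (orientations q S V) {Y. Y \<subseteq> V \<and> target b ` Y = Y}"
  proof (rule bij_betw_byWitness[where f' = ?G]; intro ballI subsetI)
    fix c assume "c \<in> orientations q S V"
    then have c: "c \<in> S \<rightarrow>\<^sub>E {0, 1}" by (simp add: orientations_def)
    show "?G (?F c) = c"
    proof (rule PiE_ext[OF G01 c])
      fix x assume x: "x \<in> S"
      have "b x \<in> {0, 1}" "c x \<in> {0, 1}" "q (x, b x) \<in> V"
        using orientation_in[OF x] c x hash_in[OF x] by auto
      then show "?G (?F c) x = c x" using x owner_hash[OF x] by auto
    qed
  next
    fix Y assume "Y \<in> {Y. Y \<subseteq> V \<and> target b ` Y = Y}"
    then show "?F (?G Y) = Y" by (intro GF) simp
  next
    fix Y assume "Y \<in> ?F ` orientations q S V"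
    then obtain c where c: "c \<in> S \<rightarrow>\<^sub>E {0, 1}" "bij_betw (\<lambda>x. q (x, c x)) S V" "Y = ?F c"
      unfolding orientations_def by blast
    have "c \<in> S \<rightarrow> {0, 1}" using c(1) by (simp add: PiE_iff)
    then have "target b ` ?F c = ?F c" using flip c(2) by blast
    moreover have "?F c \<subseteq> V" by blast
    ultimately show "Y \<in> {Y. Y \<subseteq> V \<and> target b ` Y = Y}" unfolding c(3) by simp
  next
    fix c assume "c \<in> ?G ` {Y. Y \<subseteq> V \<and> target b ` Y = Y}"
    then obtain Y where Y: "Y \<subseteq> V" "target b ` Y = Y" "c = ?G Y" by blast
    have "?G Y \<in> S \<rightarrow> {0, 1}" using G01[of Y] by (simp add: PiE_iff)
    then have "bij_betw (\<lambda>x. q (x, ?G Y x)) S V" by (rule flip[THEN iffD2]) (simp only: GF[OF Y(1)] Y(2))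
    then show "c \<in> orientations q S V" unfolding orientations_def Y(3) using G01 by blast
  qed
  then have "card (orientations q S V) = card {Y. Y \<subseteq> V \<and> target b ` Y = Y}"
    by (rule bij_betw_same_card)
  also have "\<dots> = 2 ^ component_count V (fgraph V (target b))"
    by (rule card_fixed_subsets[OF finV target_image])
  finally show ?thesis
    unfolding multigraph_components_def adjacency_orientation component_count_def by (simp add: hash_graph_def V)
qed

end

text \<open>The selected edges are distinct and there are as many edges as nodes. So every edge is
  selected exactly once and can take the selecting node as its tail.\<close>

lemma pseudoforest_imp_orientation:
  assumes "finite S" "card S = n" "pseudoforest (hash_graph n S q)"
  shows "orientations q S V \<noteq> {}"
proof -
  let ?H = "hash_graph n S q"
  have "\<exists>m. inj_on m (nodes ?H) \<and> m ` nodes ?H \<subseteq> edges ?H \<and> (\<forall>v\<in>nodes ?H. v \<in> ends ?H (m v))"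
    using assms(3) hash_in by (intro pseudoforest_selector) (auto simp: hash_graph_def V)
  then obtain m where m: "inj_on m V" "m ` V \<subseteq> S" "\<And>v. v \<in> V \<Longrightarrow> v = q (m v, 0) \<or> v = q (m v, 1)"
    by (auto simp: hash_graph_def V)
  have "m ` V = S"
    using m assms by (intro card_subset_eq) (auto simp: card_image V)
  then have bij: "bij_betw m V S" using m by (simp add: bij_betw_def)
  \<comment> \<open>If the end at position 0 is not the selecting node, the end at position 1 must
    be. Loops get the value 0.\<close>
  define b where "b = (\<lambda>x\<in>S. if q (x, 0) = inv_into V m x then 0 else 1 :: nat)"
  have "q (x, b x) = inv_into V m x" if "x \<in> S" for x
  proof -
    have "inv_into V m x \<in> V" using that bij by (metis bij_betw_imp_surj_on inv_into_into)
    from m(3)[OF this] show ?thesis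
      using that bij_betw_inv_into_right[OF bij that] by (auto simp: b_def)
  qed
  then have "bij_betw (\<lambda>x. q (x, b x)) S V"
    using bij_betw_inv_into[OF bij] by (subst bij_betw_cong[of S _ "inv_into V m"]) auto
  then have "b \<in> orientations q S V" by (auto simp: orientations_def b_def)
  then show ?thesis by blast
qed

end

text \<open>Once \<open>b\<close> is fixed, \<open>q\<close> amounts to an arbitrary bijection
  \<open>\<pi>\<close> from edges to tails and an arbitrary function \<open>f\<close> from tails to
  heads. The graph depends on \<open>f\<close> alone, so the choices of \<open>b\<close> and
  \<open>\<pi>\<close> factor out.\<close>

lemma sum_orientations:
  fixes h :: "(nat \<times> nat) set \<Rightarrow> real"
  assumes "finite S" and V: "V = {1..n}"
  shows "(\<Sum>q\<in>S \<times> {0, 1} \<rightarrow>\<^sub>E V. \<Sum>b\<in>orientations q S V. h (adjacency (hash_graph n S q))) =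
    real (card (S \<rightarrow>\<^sub>E {0, 1 :: nat}) * card {\<pi> \<in> S \<rightarrow>\<^sub>E V. bij_betw \<pi> S V}) *
    (\<Sum>f\<in>V \<rightarrow>\<^sub>E V. h (fgraph V f))"
proof -
  let ?Q = "S \<times> {0, 1 :: nat} \<rightarrow>\<^sub>E V" and ?B = "S \<rightarrow>\<^sub>E {0, 1 :: nat}"
  let ?P = "{\<pi> \<in> S \<rightarrow>\<^sub>E V. bij_betw \<pi> S V}"
  have fin: "finite ?Q" "finite ?B" "finite ?P" "finite (V \<rightarrow>\<^sub>E V)"
    using assms by (auto intro!: finite_PiE)
  \<comment> \<open>\<open>j\<close> reads off tails and heads; \<open>i\<close> writes the tail at
    position \<open>b x\<close> and the head at the other position.\<close>
  have one: "(\<Sum>q\<in>{q \<in> ?Q. bij_betw (\<lambda>x. q (x, b x)) S V}. h (adjacency (hash_graph n S q))) =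
      (\<Sum>(\<pi>, f)\<in>?P \<times> (V \<rightarrow>\<^sub>E V). h (fgraph V f))" if b: "b \<in> ?B" for b
  proof (rule sum.reindex_bij_witness[where
        j = "\<lambda>q. (\<lambda>x\<in>S. q (x, b x), \<lambda>v\<in>V. target S q b v)" and
        i = "\<lambda>(\<pi>, f). \<lambda>(x, c)\<in>S \<times> {0, 1}. if c = b x then \<pi> x else f (\<pi> x)"])
    fix q assume "q \<in> {q \<in> ?Q. bij_betw (\<lambda>x. q (x, b x)) S V}"
    then have qE: "q \<in> ?Q" and q: "q \<in> S \<times> {0, 1} \<rightarrow> {1..n}" and bo: "b \<in> orientations q S V"
      using b by (auto simp: orientations_def V PiE_def)
    note owner_hash = owner_hash[OF q V bo] and target_image = target_image[OF q V bo]
    have bx: "b x \<in> {0, 1}" if "x \<in> S" for x using b that by auto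
    have qV: "q (x, b x) \<in> V" if "x \<in> S" for x using hash_in[OF q V that bx[OF that]] .
    show "(case (\<lambda>x\<in>S. q (x, b x), \<lambda>v\<in>V. target S q b v) of (\<pi>, f) \<Rightarrow>
        \<lambda>(x, c)\<in>S \<times> {0, 1}. if c = b x then \<pi> x else f (\<pi> x)) = q" (is "?L = q")
    proof
      fix y :: "'a \<times> nat"
      obtain x c where y: "y = (x, c)" by (cases y)
      show "?L y = q y"
      proof (cases "y \<in> S \<times> {0, 1}")
        case True
        then have x: "x \<in> S" "c \<in> {0, 1}" using y by auto
        have "1 - b x = c" if "c \<noteq> b x" using x bx[OF x(1)] that by auto
        then show ?thesis
          using x y qV[OF x(1)] owner_hash[OF x(1)] by (auto simp: target_def[OF q V])
      next
        case False
        then show ?thesis using qE PiE_arb[OF qE False] y by auto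
      qed
    qed
    show "(\<lambda>x\<in>S. q (x, b x), \<lambda>v\<in>V. target S q b v) \<in> ?P \<times> (V \<rightarrow>\<^sub>E V)"
    proof -
      have "bij_betw (\<lambda>x\<in>S. q (x, b x)) S V"
        using bo by (subst bij_betw_cong[of S _ "\<lambda>x. q (x, b x)"]) (auto simp: orientations_def)
      then show ?thesis using qV target_image by (auto simp: image_subset_iff)
    qed
    have "fgraph V (\<lambda>v\<in>V. target S q b v) = fgraph V (target S q b)"
      by (rule fgraph_cong) simp
    then show "(case (\<lambda>x\<in>S. q (x, b x), \<lambda>v\<in>V. target S q b v) of (\<pi>, f) \<Rightarrow> h (fgraph V f)) =
        h (adjacency (hash_graph n S q))"
      using adjacency_orientation[OF q V bo] by simp
  next
    fix p assume "p \<in> ?P \<times> (V \<rightarrow>\<^sub>E V)"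
    then obtain \<pi> f where p: "p = (\<pi>, f)" "\<pi> \<in> S \<rightarrow>\<^sub>E V" "bij_betw \<pi> S V" "f \<in> V \<rightarrow>\<^sub>E V" by auto
    define q where "q = (\<lambda>(x, c)\<in>S \<times> {0, 1}. if c = b x then \<pi> x else f (\<pi> x))"
    have bx: "b x \<in> {0, 1}" if "x \<in> S" for x using b that by auto
    have qx: "q (x, b x) = \<pi> x" "q (x, 1 - b x) = f (\<pi> x)" if "x \<in> S" for x
      using bx[OF that] that by (auto simp: q_def)
    have "\<pi> x \<in> V" "f (\<pi> x) \<in> V" if "x \<in> S" for x
      using p(2,4) that by (auto intro: PiE_mem)
    then have qE: "q \<in> ?Q" by (auto simp: q_def)
    then have q: "q \<in> S \<times> {0, 1} \<rightarrow> {1..n}" by (auto simp: V PiE_def)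
    have qbij: "bij_betw (\<lambda>x. q (x, b x)) S V"
      using p(3) qx by (subst bij_betw_cong[of S _ \<pi>]) auto
    have bo: "b \<in> orientations q S V" using b qbij by (simp add: orientations_def)
    have eq: "(case p of (\<pi>, f) \<Rightarrow> \<lambda>(x, c)\<in>S \<times> {0, 1}. if c = b x then \<pi> x else f (\<pi> x)) = q"
      by (simp add: p(1) q_def)
    show "(case p of (\<pi>, f) \<Rightarrow> \<lambda>(x, c)\<in>S \<times> {0, 1}. if c = b x then \<pi> x else f (\<pi> x))
        \<in> {q \<in> ?Q. bij_betw (\<lambda>x. q (x, b x)) S V}"
      unfolding eq using qE qbij by simp
    have "(\<lambda>x\<in>S. q (x, b x)) = \<pi>"
      by (rule PiE_ext[OF _ p(2)]) (use qx p(2) in auto)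
    moreover have "(\<lambda>v\<in>V. target S q b v) = f"
    proof (rule extensionalityI[of _ V])
      show "f \<in> extensional V" using p(4) by (simp add: PiE_def)
      fix v assume v: "v \<in> V"
      have "target S q b v = f (\<pi> (owner S q b v))"
        unfolding target_def[OF q V] using qx(2) owner_in[OF q V bo v] by simp
      also have "\<pi> (owner S q b v) = v"
        using hash_owner[OF q V bo v] qx(1) owner_in[OF q V bo v] by simp
      finally show "(\<lambda>v\<in>V. target S q b v) v = f v" using v by simp
    qed simp
    ultimately show "(\<lambda>x\<in>S. (case p of (\<pi>, f) \<Rightarrow> \<lambda>(x, c)\<in>S \<times> {0, 1}. if c = b x then \<pi> x else f (\<pi> x)) (x, b x),
       \<lambda>v\<in>V. target S (case p of (\<pi>, f) \<Rightarrow> \<lambda>(x, c)\<in>S \<times> {0, 1}. if c = b x then \<pi> x else f (\<pi> x)) b v) = p"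
      unfolding eq by (simp add: p(1))
  qed
  have "(\<Sum>q\<in>?Q. \<Sum>b\<in>orientations q S V. h (adjacency (hash_graph n S q))) =
     (\<Sum>b\<in>?B. \<Sum>q\<in>{q \<in> ?Q. bij_betw (\<lambda>x. q (x, b x)) S V}. h (adjacency (hash_graph n S q)))"
    unfolding orientations_def by (rule sum.swap_restrict[OF fin(1,2)])
  also have "\<dots> = (\<Sum>b\<in>?B. \<Sum>(\<pi>, f)\<in>?P \<times> (V \<rightarrow>\<^sub>E V). h (fgraph V f))"
    by (rule sum.cong[OF refl one])
  also have "\<dots> = real (card ?B) * (real (card ?P) * (\<Sum>f\<in>V \<rightarrow>\<^sub>E V. h (fgraph V f)))"
    by (simp add: sum.cartesian_product[symmetric])
  finally show ?thesis by simp
qed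

section \<open>Components of random functions\<close>

text \<open>Expanding \<open>z = (z - 1) + 1\<close> for every cycle gives the closed forms below: \<open>m\<close> is the number of nodes on
  marked cycles among the \<open>r\<close> isolated nodes, the images of the other nodes are arbitrary, and
  \<^term>\<open>pochhammer (z - 1) m\<close> counts permutations of the marked nodes with weight \<open>z - 1\<close> per cycle. In \<open>path_weight\<close> the path
  currently followed lies on a marked cycle as well.\<close>
definition total_weight :: "real \<Rightarrow> nat \<Rightarrow> nat \<Rightarrow> real" where
  "total_weight z n r = (\<Sum>m\<le>r. real (r choose m) * pochhammer (z - 1) m * real n ^ (r - m))"

definition path_weight :: "real \<Rightarrow> nat \<Rightarrow> nat \<Rightarrow> real" where
  "path_weight z n r = (\<Sum>m\<le>r. real (r choose m) * pochhammer (z - 1) (Suc m) * real n ^ (r - m))"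

lemma total_weight_0 [simp]: "total_weight z n 0 = 1"
  by (simp add: total_weight_def)

lemma path_weight_0 [simp]: "path_weight z n 0 = z - 1"
  by (simp add: path_weight_def)

text \<open>Pascal's rule. An additional node is either unmarked, with \<open>n\<close> possible
  images, or it opens a path on a marked cycle.\<close>

lemma total_weight_Suc: "total_weight z n (Suc r) = real n * total_weight z n r + path_weight z n r"
proof -
  have "total_weight z n (Suc r) = real n ^ Suc r +
     (\<Sum>m\<le>r. real (Suc r choose Suc m) * pochhammer (z - 1) (Suc m) * real n ^ (r - m))"
    unfolding total_weight_def by (subst sum.atMost_Suc_shift) simp
  also have "\<dots> = (real n ^ Suc r +
     (\<Sum>m\<le>r. real (r choose Suc m) * pochhammer (z - 1) (Suc m) * real n ^ (r - m))) + path_weight z n r"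
    unfolding path_weight_def by (simp add: sum.distrib[symmetric] algebra_simps)
  also have "real n ^ Suc r +
     (\<Sum>m\<le>r. real (r choose Suc m) * pochhammer (z - 1) (Suc m) * real n ^ (r - m)) =
     (\<Sum>m\<le>Suc r. real (r choose m) * pochhammer (z - 1) m * real n ^ (Suc r - m))"
    by (subst sum.atMost_Suc_shift) simp
  also have "\<dots> = real n * total_weight z n r"
    by (simp add: total_weight_def sum_distrib_left Suc_diff_le mult_ac)
  finally show ?thesis .
qed

text \<open>The last factor \<open>z - 1 + m\<close> of the Pochhammer symbol is split. The marked
  path either closes, with weight \<open>z - 1\<close>, or continues to one of the
  \<open>Suc r\<close> other nodes; the latter part uses \<open>Suc_times_binomial\<close>.\<close>

lemma path_weight_Suc: "path_weight z n (Suc r) = real (Suc r) * path_weight z n r + (z - 1) * total_weight z n (Suc r)"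
proof -
  have "path_weight z n (Suc r) = (\<Sum>m\<le>Suc r. real (Suc r choose m) * pochhammer (z - 1) m * real n ^ (Suc r - m) * real m)
     + (z - 1) * total_weight z n (Suc r)"
    unfolding path_weight_def total_weight_def
    by (simp add: sum_distrib_left sum.distrib[symmetric] pochhammer_Suc algebra_simps del: binomial_Suc_Suc)
  also have "(\<Sum>m\<le>Suc r. real (Suc r choose m) * pochhammer (z - 1) m * real n ^ (Suc r - m) * real m)
     = (\<Sum>m\<le>r. real (Suc m * (Suc r choose Suc m)) * pochhammer (z - 1) (Suc m) * real n ^ (r - m))"
    by (subst sum.atMost_Suc_shift) (auto intro!: sum.cong simp: algebra_simps simp del: binomial_Suc_Suc)
  also have "\<dots> = real (Suc r) * path_weight z n r"
    unfolding Suc_times_binomial path_weight_def sum_distrib_left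
    by (auto intro!: sum.cong simp: algebra_simps)
  finally show ?thesis .
qed

section \<open>Revealing a random function value by value\<close>

definition completions :: "'v set \<Rightarrow> 'v set \<Rightarrow> ('v \<Rightarrow> 'v) \<Rightarrow> ('v \<Rightarrow> 'v) set" where
  "completions V D g = {f \<in> V \<rightarrow>\<^sub>E V. \<forall>x\<in>D. f x = g x}"

lemma sum_completions_step:
  fixes h :: "('v \<Rightarrow> 'v) \<Rightarrow> real"
  assumes "finite V" "v \<in> V" "v \<notin> D"
  shows "(\<Sum>f\<in>completions V D g. h f) = (\<Sum>u\<in>V. \<Sum>f\<in>completions V (insert v D) (g(v := u)). h f)"
proof -
  have fin: "finite (completions V D g)" for D g
    unfolding completions_def by (rule finite_subset[of _ "V \<rightarrow>\<^sub>E V"]) (auto intro: finite_PiE assms(1))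
  have disj: "completions V (insert v D) (g(v := u)) \<inter> completions V (insert v D) (g(v := u')) = {}" if "u \<noteq> u'" for u u'
    using that by (auto simp: completions_def)
  have "completions V D g = (\<Union>u\<in>V. completions V (insert v D) (g(v := u)))"
  proof (intro set_eqI iffI)
    fix f assume f: "f \<in> completions V D g"
    then have "f v \<in> V" "f \<in> completions V (insert v D) (g(v := f v))"
      using assms by (auto simp: completions_def)
    then show "f \<in> (\<Union>u\<in>V. completions V (insert v D) (g(v := u)))" by blast
  next
    fix f assume "f \<in> (\<Union>u\<in>V. completions V (insert v D) (g(v := u)))"
    then obtain u where "f \<in> completions V (insert v D) (g(v := u))" by blast
    then have f: "f \<in> V \<rightarrow>\<^sub>E V" "\<And>x. x \<in> insert v D \<Longrightarrow> f x = (g(v := u)) x"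
      unfolding completions_def by blast+
    have "f x = g x" if "x \<in> D" for x using f(2)[of x] that assms(3) by (auto split: if_splits)
    then show "f \<in> completions V D g" using f(1) by (simp add: completions_def)
  qed
  then have "(\<Sum>f\<in>completions V D g. h f) = (\<Sum>f\<in>(\<Union>u\<in>V. completions V (insert v D) (g(v := u))). h f)"
    by (rule arg_cong)
  also have "\<dots> = (\<Sum>u\<in>V. \<Sum>f\<in>completions V (insert v D) (g(v := u)). h f)"
    using assms(1) fin disj by (intro sum.UNION_disjoint) blast+
  finally show ?thesis .
qed

lemma completions_full:
  assumes "g ` V \<subseteq> V"
  shows "completions V V g = {restrict g V}"
proof (intro equalityI subsetI)
  fix f assume "f \<in> completions V V g"
  then have "f \<in> extensional V" "\<forall>x\<in>V. f x = g x" by (auto simp: completions_def PiE_def)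
  then show "f \<in> {restrict g V}" by (auto intro: extensionalityI)
next
  fix f assume "f \<in> {restrict g V}"
  then show "f \<in> completions V V g" using assms by (auto simp: completions_def)
qed

text \<open>The values of \<open>f\<close> are revealed one at a time. \<open>A\<close> is the set of nodes already known to lead to a
  cycle inside \<open>A\<close>, and \<open>P\<close> is the path currently followed, whose last node \<open>v\<close> has an unknown
  image; all other nodes are isolated.\<close>
lemma sum_completions_state:
  fixes z :: real
  assumes "finite V" "card V = n"
  assumes "A \<inter> P = {}" "A \<union> P \<subseteq> V" "v \<in> P" "D = A \<union> P - {v}"
    and "fgraph D g \<subseteq> A \<times> A \<union> P \<times> P" "P \<times> P \<subseteq> (fgraph D g)\<^sup>*" "card (V - (A \<union> P)) = r"
  shows "(\<Sum>f\<in>completions V D g. z ^ component_count V (fgraph V f)) * z ^ Suc r =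
         z ^ component_count V (fgraph D g) * (real n * total_weight z n r + real (card P) * path_weight z n r)"
  using assms(3-)
\<comment> \<open>The \<open>r\<close> isolated nodes and the current path count as
  \<open>Suc r\<close> components of \<open>fgraph D g\<close>; the factor \<open>z ^ Suc r\<close>
  compensates for them without a division.\<close>
proof (induction r arbitrary: A P v D g rule: less_induct)
  case (less r)
  let ?Z = "\<lambda>D g. \<Sum>f\<in>completions V D g. z ^ component_count V (fgraph V f)"
  let ?R = "fgraph D g"
  define g' where "g' u = g(v := u)" for u
  note [simp] = assms(1)
  have vV: "v \<in> V" "v \<notin> D" and AP: "insert v D = A \<union> P" using less.prems by auto
  have finAP: "finite A" "finite P" using less.prems by (auto intro: finite_subset[OF _ assms(1)])
  have RV: "?R \<subseteq> V \<times> V" using less.prems by auto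
  have gr: "fgraph (A \<union> P) (g' u) = insert (v, u) (insert (u, v) ?R)" for u
    using fgraph_insert[OF vV(2)] AP by (simp add: g'_def)
  \<comment> \<open>No revealed edge leaves \<open>P\<close>, and \<open>P\<close> is connected, so
    \<open>P\<close> is the component of \<open>v\<close>.\<close>
  have conn: "(v, u) \<in> ?R\<^sup>* \<longleftrightarrow> u \<in> P" for u
  proof
    assume "(v, u) \<in> ?R\<^sup>*"
    then show "u \<in> P" by (rule rtrancl_closed) (use less.prems in auto)
  next
    assume "u \<in> P" then show "(v, u) \<in> ?R\<^sup>*" using less.prems by auto
  qed
  have cc': "component_count V ?R = component_count V (fgraph (A \<union> P) (g' u)) + (if u \<in> P then 0 else 1)" if "u \<in> V" for u
    using component_count_add_edge[OF assms(1) RV sym_fgraph vV(1) that] by (simp add: gr conn)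
  \<comment> \<open>If the image \<open>u\<close> lies in \<open>A \<union> P\<close>, the whole
    path leads to a cycle and is absorbed into \<open>A\<close>. A new path then starts at any
    isolated node, unless none is left.\<close>
  have closed: "?Z (A \<union> P) (g' u) * z ^ r = z ^ component_count V (fgraph (A \<union> P) (g' u)) * total_weight z n r"
    if u: "u \<in> A \<union> P" for u
  proof (cases r)
    case 0
    then have V: "A \<union> P = V" using less.prems by auto
    have "g' u ` V \<subseteq> V"
    proof
      fix y assume "y \<in> g' u ` V"
      then obtain x where x: "x \<in> V" "y = g' u x" by auto
      then have "(x, y) \<in> fgraph (A \<union> P) (g' u)" by (auto simp: fgraph_def V)
      then show "y \<in> V" unfolding gr using u vV RV V by auto
    qed
    then have "completions V (A \<union> P) (g' u) = {restrict (g' u) V}" using completions_full V by simp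
    moreover have "fgraph V (restrict (g' u) V) = fgraph (A \<union> P) (g' u)"
      unfolding V by (rule fgraph_cong) simp
    ultimately show ?thesis using 0 by simp
  next
    case (Suc r')
    then have "V - (A \<union> P) \<noteq> {}" using less.prems by (metis card.empty nat.distinct(1))
    then obtain v' where v': "v' \<in> V" "v' \<notin> A \<union> P" by blast
    have "card (V - (A \<union> P \<union> {v'})) = card ((V - (A \<union> P)) - {v'})"
      by (rule arg_cong[of _ _ card]) auto
    also have "\<dots> = r'" using v' Suc less.prems by (subst card_Diff_singleton) auto
    finally have c: "card (V - (A \<union> P \<union> {v'})) = r'" .
    have "?Z (A \<union> P) (g' u) * z ^ Suc r' = z ^ component_count V (fgraph (A \<union> P) (g' u)) *
        (real n * total_weight z n r' + real (card {v'}) * path_weight z n r')"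
      by (rule less.IH[where A = "A \<union> P" and P = "{v'}" and v = v'])
         (use Suc v' c less.prems u gr[of u] in auto)
    then show ?thesis by (simp add: Suc total_weight_Suc)
  qed
  \<comment> \<open>An image in \<open>P\<close> closes a cycle and keeps the component count; an
    image in \<open>A\<close> lowers it by one. This explains the extra factor \<open>z\<close> for
    \<open>P\<close>.\<close>
  have Zin: "?Z (A \<union> P) (g' u) * z ^ Suc r = z ^ component_count V ?R * (if u \<in> P then z else 1) * total_weight z n r"
    if u: "u \<in> A \<union> P" for u
    using closed[OF u] cc'[of u] u less.prems by (auto simp: mult_ac power_add)
  \<comment> \<open>An isolated image becomes the new end of the path: \<open>P\<close> grows by one
    node and \<open>r\<close> drops by one.\<close>
  have Zout: "?Z (A \<union> P) (g' u) * z ^ Suc r = z ^ component_count V ?R *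
      (real n * total_weight z n (r - 1) + real (card P + 1) * path_weight z n (r - 1))"
    if u: "u \<in> V - (A \<union> P)" for u
  proof -
    have r: "r > 0" using u less.prems by (auto simp: card_gt_0_iff)
    have "card (V - (A \<union> insert u P)) = card ((V - (A \<union> P)) - {u})"
      by (rule arg_cong[of _ _ card]) auto
    also have "\<dots> = r - 1" using u less.prems by (subst card_Diff_singleton) auto
    finally have c: "card (V - (A \<union> insert u P)) = r - 1" .
    let ?R' = "fgraph (A \<union> P) (g' u)"
    have mono: "?R\<^sup>* \<subseteq> ?R'\<^sup>*" unfolding gr by (rule rtrancl_mono) auto
    have uv: "(u, v) \<in> ?R'\<^sup>*" "(v, u) \<in> ?R'\<^sup>*" unfolding gr by auto
    have PP: "(x, y) \<in> ?R'\<^sup>*" if "x \<in> P" "y \<in> P" for x y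
      using that less.prems mono by auto
    have "insert u P \<times> insert u P \<subseteq> ?R'\<^sup>*"
      using PP uv \<open>v \<in> P\<close> by (auto intro: rtrancl_trans[of _ v])
    then have "?Z (A \<union> P) (g' u) * z ^ Suc (r - 1) = z ^ component_count V ?R' *
        (real n * total_weight z n (r - 1) + real (card (insert u P)) * path_weight z n (r - 1))"
      by (intro less.IH[where A = A and P = "insert u P" and v = u])
         (use u r c less.prems gr[of u] in auto)
    moreover have "card (insert u P) = card P + 1" using u finAP by auto
    ultimately show ?thesis using cc'[of u] u r by (auto simp: mult_ac)
  qed
  have cardV: "real n = real (card A) + real (card P) + real r"
  proof -
    have "card V = card (A \<union> P) + card (V - (A \<union> P))"
      using less.prems finAP card_mono[OF assms(1) \<open>A \<union> P \<subseteq> V\<close>] by (subst card_Diff_subset) auto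
    then show ?thesis using assms(2) less.prems finAP by (simp add: card_Un_disjoint)
  qed
  have "?Z D g * z ^ Suc r = (\<Sum>u\<in>V. ?Z (A \<union> P) (g' u) * z ^ Suc r)"
    by (subst sum_completions_step[OF assms(1) vV]) (simp add: AP g'_def sum_distrib_right)
  also have "\<dots> = (\<Sum>u\<in>A. ?Z (A \<union> P) (g' u) * z ^ Suc r) + (\<Sum>u\<in>P. ?Z (A \<union> P) (g' u) * z ^ Suc r)
       + (\<Sum>u\<in>V - (A \<union> P). ?Z (A \<union> P) (g' u) * z ^ Suc r)"
    using less.prems finAP
    by (simp only: sum.union_disjoint[symmetric] sum.subset_diff[OF \<open>A \<union> P \<subseteq> V\<close> assms(1)] add.commute)
  also have "(\<Sum>u\<in>A. ?Z (A \<union> P) (g' u) * z ^ Suc r) = (\<Sum>u\<in>A. z ^ component_count V ?R * total_weight z n r)"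
    by (rule sum.cong[OF refl], subst Zin) (use less.prems in auto)
  also have "(\<Sum>u\<in>P. ?Z (A \<union> P) (g' u) * z ^ Suc r) = (\<Sum>u\<in>P. z ^ component_count V ?R * z * total_weight z n r)"
    by (rule sum.cong[OF refl], subst Zin) auto
  also have "(\<Sum>u\<in>V - (A \<union> P). ?Z (A \<union> P) (g' u) * z ^ Suc r) =
     (\<Sum>u\<in>V - (A \<union> P). z ^ component_count V ?R *
      (real n * total_weight z n (r - 1) + real (card P + 1) * path_weight z n (r - 1)))"
    by (rule sum.cong[OF refl Zout])
  finally have eq: "?Z D g * z ^ Suc r = z ^ component_count V ?R *
     ((real (card A) + z * real (card P)) * total_weight z n r +
      real r * (real n * total_weight z n (r - 1) + real (card P + 1) * path_weight z n (r - 1)))"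
    using less.prems by (simp add: algebra_simps)
  \<comment> \<open>The two recurrences remove the index \<open>r - 1\<close>. For
    \<open>r = 0\<close> both sides vanish, because
    \<open>path_weight z n 0 = z - 1\<close>.\<close>
  have "real r * (real n * total_weight z n (r - 1) + real (card P + 1) * path_weight z n (r - 1)) =
      real r * total_weight z n r + real (card P) * (path_weight z n r - (z - 1) * total_weight z n r)"
    by (cases r) (simp_all add: total_weight_Suc path_weight_Suc algebra_simps)
  then have "(real (card A) + z * real (card P)) * total_weight z n r +
      real r * (real n * total_weight z n (r - 1) + real (card P + 1) * path_weight z n (r - 1)) =
      real n * total_weight z n r + real (card P) * path_weight z n r"
    by (simp add: cardV algebra_simps)
  with eq show ?case by simp
qed

text \<open>Start with nothing revealed: \<open>A\<close> is empty, the path is a single node, and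
  the other \<open>n - 1\<close> nodes are isolated. Both sides then carry the factor
  \<open>z ^ n\<close>, which cancels.\<close>

lemma sum_components:
  fixes z :: real
  assumes "finite V" "card V = n" "n > 0" "z \<noteq> 0"
  shows "(\<Sum>f\<in>V \<rightarrow>\<^sub>E V. z ^ component_count V (fgraph V f)) = total_weight z n n"
proof -
  obtain v where v: "v \<in> V" using assms by fastforce
  have e: "completions V {} g = V \<rightarrow>\<^sub>E V" for g by (auto simp: completions_def)
  have [simp]: "fgraph {} g = {}" for g by (auto simp: fgraph_def)
  have q: "V // Id = (\<lambda>x. {x}) ` V" by (auto simp: quotient_def)
  have c: "component_count V {} = n" using assms by (simp add: component_count_def q card_image)
  obtain r where r: "n = Suc r" using assms by (cases n) auto
  have "(\<Sum>f\<in>completions V {} id. z ^ component_count V (fgraph V f)) * z ^ Suc r =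
         z ^ component_count V (fgraph {} id) * (real n * total_weight z n r + real (card {v}) * path_weight z n r)"
    by (rule sum_completions_state[where A = "{}" and v = v])
       (use assms v r in \<open>auto simp: card_Diff_singleton\<close>)
  then show ?thesis using assms(4) by (simp add: e c r total_weight_Suc)
qed

section \<open>The number of cyclic nodes of a random function, and the size of the mean\<close>

definition falling_ratio :: "nat \<Rightarrow> nat \<Rightarrow> real" where
  "falling_ratio n m = (\<Prod>i<m. 1 - real i / real n)"

text \<open>The mean of \<open>z\<close> to the number of cycles of a uniform permutation of
  \<open>m\<close> elements.\<close>

definition rising_ratio :: "real \<Rightarrow> nat \<Rightarrow> real" where
  "rising_ratio z m = pochhammer z m / fact m"

text \<open>\<open>falling_ratio n m\<close> is the probability that a random function on
  \<open>n\<close> nodes has at least \<open>m\<close> cyclic nodes, so its differences are the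
  probabilities of exactly \<open>m\<close>.\<close>

definition cycle_mean :: "real \<Rightarrow> nat \<Rightarrow> real" where
  "cycle_mean z n = (\<Sum>m\<le>n. (falling_ratio n m - falling_ratio n (Suc m)) * rising_ratio z m)"

lemma falling_ratio_0 [simp]: "falling_ratio n 0 = 1"
  by (simp add: falling_ratio_def)

lemma falling_ratio_Suc: "falling_ratio n (Suc m) = falling_ratio n m * (1 - real m / real n)"
  by (simp add: falling_ratio_def)

lemma falling_ratio_nonneg: "m \<le> Suc n \<Longrightarrow> falling_ratio n m \<ge> 0"
  unfolding falling_ratio_def by (rule prod_nonneg) (auto simp: divide_le_eq_1)

lemma falling_ratio_mono: "m \<le> n \<Longrightarrow> falling_ratio n (Suc m) \<le> falling_ratio n m"
  unfolding falling_ratio_Suc by (rule mult_left_le) (auto intro: falling_ratio_nonneg)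

lemma falling_ratio_le_1: "m \<le> n \<Longrightarrow> falling_ratio n m \<le> 1"
  unfolding falling_ratio_def by (rule prod_le_1) (auto simp: divide_le_eq_1)

lemma falling_ratio_vanish: "n > 0 \<Longrightarrow> falling_ratio n (Suc n) = 0"
  by (simp add: falling_ratio_Suc)

text \<open>Multiply \<open>1 - x \<le> exp (- x)\<close> over the factors with
  \<open>i \<le> k\<close>; these indices add up to \<open>k * Suc k / 2\<close>.\<close>

lemma falling_ratio_le_exp:
  assumes "k \<le> n"
  shows "falling_ratio n (Suc k) \<le> exp (- (real k * real (Suc k) / (2 * real n)))"
  using assms
proof (induction k)
  case 0
  then show ?case by (simp add: falling_ratio_Suc)
next
  case (Suc k)
  have "falling_ratio n (Suc (Suc k)) = falling_ratio n (Suc k) * (1 - real (Suc k) / real n)"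
    by (rule falling_ratio_Suc)
  also have "\<dots> \<le> exp (- (real k * real (Suc k) / (2 * real n))) * exp (- (real (Suc k) / real n))"
    using Suc exp_ge_add_one_self[of "- (real (Suc k) / real n)"] falling_ratio_nonneg[of "Suc k" n]
    by (intro mult_mono) (auto simp: field_simps)
  also have "\<dots> = exp (- (real (Suc k) * real (Suc (Suc k)) / (2 * real n)))"
    unfolding exp_add[symmetric] using Suc by (intro arg_cong[of _ _ exp]) (simp add: field_simps)
  finally show ?case .
qed

lemma binomial_falling_ratio:
  assumes "n > 0" "m \<le> n"
  shows "real (n choose m) = real n ^ m * falling_ratio n m / fact m"
  using assms(2)
proof (induction m)
  case (Suc m)
  have "real (Suc m) * real (n choose Suc m) = (real n - real m) * real (n choose m)"
    using Suc.prems binomial_absorb_comp[of n m] binomial_absorption[of m n]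
    by (metis Suc_leD of_nat_diff of_nat_mult)
  then have "real (n choose Suc m) = (real n - real m) * real (n choose m) / real (Suc m)"
    by (simp add: field_simps)
  also have "\<dots> = real n ^ Suc m * falling_ratio n (Suc m) / fact (Suc m)"
  proof -
    have "real (n choose m) = real n ^ m * falling_ratio n m / fact m"
      using Suc by simp
    moreover have "real n ^ Suc m * falling_ratio n (Suc m) = (real n - real m) * (real n ^ m * falling_ratio n m)"
      using assms(1) by (simp add: falling_ratio_Suc field_simps)
    ultimately show ?thesis by (simp add: mult_ac del: power_Suc)
  qed
  finally show ?case .
qed simp

lemma rising_ratio_0 [simp]: "rising_ratio z 0 = 1"
  by (simp add: rising_ratio_def)

lemma rising_ratio_Suc: "rising_ratio z (Suc m) = rising_ratio z m * ((z + real m) / real (Suc m))"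
  by (simp add: rising_ratio_def pochhammer_Suc field_simps)

text \<open>Identifies the coefficients in \<open>total_weight\<close> as differences, ready for
  summation by parts.\<close>

lemma rising_ratio_diff:
  "rising_ratio z (Suc m) - rising_ratio z m = pochhammer (z - 1) (Suc m) / fact (Suc m)"
proof -
  have "pochhammer (z - 1) (Suc m) = (z - 1) * pochhammer z m" by (simp add: pochhammer_rec)
  moreover have "rising_ratio z (Suc m) - rising_ratio z m = rising_ratio z m * ((z - 1) / real (Suc m))"
    by (simp add: rising_ratio_Suc field_simps)
  ultimately show ?thesis by (simp only: rising_ratio_def fact_Suc of_nat_mult times_divide_times_eq mult_ac)
qed

lemma rising_ratio_nonneg: "z \<ge> 0 \<Longrightarrow> rising_ratio z m \<ge> 0"
  by (induction m) (simp_all add: rising_ratio_Suc)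

lemma rising_ratio_antimono:
  assumes "0 \<le> z" "z \<le> 1" "i \<le> j"
  shows "rising_ratio z j \<le> rising_ratio z i"
  using assms(3)
proof (induction rule: dec_induct)
  case (step j)
  have "rising_ratio z (Suc j) \<le> rising_ratio z j"
    unfolding rising_ratio_Suc using assms by (intro mult_left_le rising_ratio_nonneg) simp_all
  with step show ?case by simp
qed simp

text \<open>Summation by parts moves the differences from \<open>rising_ratio\<close> to
  \<open>falling_ratio\<close>. The boundary term vanishes because
  \<open>falling_ratio n (Suc n)\<close> contains the factor 0.\<close>

lemma total_weight_eq_cycle_mean:
  assumes "n > 0"
  shows "total_weight z n n = real n ^ n * cycle_mean z n"
proof -
  let ?d = "\<lambda>m. pochhammer (z - 1) m / fact m"
  have parts: "(\<Sum>m\<le>M. falling_ratio n m * ?d m) =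
     (\<Sum>m\<le>M. (falling_ratio n m - falling_ratio n (Suc m)) * rising_ratio z m)
      + falling_ratio n (Suc M) * rising_ratio z M" for M
  proof (induction M)
    case (Suc M)
    have "(\<Sum>m\<le>Suc M. falling_ratio n m * ?d m) =
       (\<Sum>m\<le>M. falling_ratio n m * ?d m) + falling_ratio n (Suc M) * (rising_ratio z (Suc M) - rising_ratio z M)"
      by (simp only: sum.atMost_Suc rising_ratio_diff)
    also have "\<dots> = (\<Sum>m\<le>Suc M. (falling_ratio n m - falling_ratio n (Suc m)) * rising_ratio z m)
      + falling_ratio n (Suc (Suc M)) * rising_ratio z (Suc M)"
      unfolding Suc.IH by (simp add: algebra_simps)
    finally show ?case .
  qed simp
  have "total_weight z n n = (\<Sum>m\<le>n. real n ^ n * (falling_ratio n m * ?d m))"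
    unfolding total_weight_def
  proof (rule sum.cong[OF refl])
    fix m assume "m \<in> {..n}"
    then have "real n ^ n = real n ^ m * real n ^ (n - m)" by (simp add: power_add[symmetric])
    then show "real (n choose m) * pochhammer (z - 1) m * real n ^ (n - m) = real n ^ n * (falling_ratio n m * ?d m)"
      using \<open>m \<in> {..n}\<close> assms by (simp add: binomial_falling_ratio)
  qed
  also have "\<dots> = real n ^ n * cycle_mean z n"
    unfolding sum_distrib_left[symmetric] parts cycle_mean_def falling_ratio_vanish[OF assms] by simp
  finally show ?thesis .
qed

text \<open>Each factor is at most the ratio of consecutive powers, by
  \<open>1 + x \<le> exp x\<close> and \<open>ln (1 + x) \<le> x\<close>; the exponent
  \<open>z - 1\<close> is not positive, which reverses the latter. The ratios telescope.\<close>

lemma rising_ratio_le_powr: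
  assumes "0 \<le> z" "z \<le> 1"
  shows "rising_ratio z m \<le> real (Suc m) powr (z - 1)"
proof (induction m)
  case (Suc m)
  have "(z + real m) / real (Suc m) = 1 + (z - 1) * (1 / real (Suc m))"
    by (simp add: field_simps)
  also have "\<dots> \<le> exp ((z - 1) * (1 / real (Suc m)))" by (rule exp_ge_add_one_self)
  also have "\<dots> \<le> exp ((z - 1) * ln (1 + 1 / real (Suc m)))"
    unfolding exp_le_cancel_iff using assms
    by (intro mult_left_mono_neg ln_add_one_self_le_self) auto
  also have "\<dots> = (1 + 1 / real (Suc m)) powr (z - 1)"
    using add_pos_nonneg[of 1 "1 / real (Suc m)"] by (simp add: powr_def)
  finally have "rising_ratio z (Suc m) \<le> real (Suc m) powr (z - 1) * (1 + 1 / real (Suc m)) powr (z - 1)"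
    unfolding rising_ratio_Suc using Suc assms by (intro mult_mono) (auto intro: rising_ratio_nonneg)
  also have "\<dots> = (real (Suc m) * (1 + 1 / real (Suc m))) powr (z - 1)"
    by (rule powr_mult[symmetric])
  also have "real (Suc m) * (1 + 1 / real (Suc m)) = real (Suc (Suc m))"
    by (simp add: field_simps)
  finally show ?case .
qed simp

text \<open>This is the central binomial coefficient over \<open>4 ^ m\<close>. Four
  \<open>m\<close> times its square equals 1 at \<open>m = 1\<close> and never decreases, since
  \<open>m * (m + 1) \<le> (m + 1/2)\<^sup>2\<close>.\<close>

lemma rising_ratio_half_ge:
  assumes "m > 0"
  shows "rising_ratio (1/2) m \<ge> 1 / (2 * sqrt (real m))"
proof -
  have "1 \<le> 4 * real m * (rising_ratio (1/2) m)\<^sup>2"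
    using assms
  proof (induction m rule: nat_induct_non_zero)
    case 1
    have "rising_ratio (1/2) 1 = 1/2" by (simp add: rising_ratio_def)
    then show ?case by (simp only:) (simp add: power2_eq_square)
  next
    case (Suc m)
    have "4 * real m * (rising_ratio (1/2) m)\<^sup>2 * 1 \<le>
      4 * real m * (rising_ratio (1/2) m)\<^sup>2 * ((1/2 + real m)\<^sup>2 / (real m * real (Suc m)))"
    proof (intro mult_left_mono)
      have "real m * real (Suc m) \<le> (1/2 + real m)\<^sup>2" by (simp add: power2_eq_square field_simps)
      then show "1 \<le> (1/2 + real m)\<^sup>2 / (real m * real (Suc m))"
        using Suc by (subst pos_le_divide_eq) auto
    qed auto
    also have "\<dots> = 4 * real (Suc m) * (rising_ratio (1/2) (Suc m))\<^sup>2"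
      using Suc unfolding rising_ratio_Suc by (simp add: divide_simps power2_eq_square del: of_nat_Suc)
    finally show ?case using Suc by simp
  qed
  then have "1 \<le> (2 * sqrt (real m) * rising_ratio (1/2) m)\<^sup>2"
    by (simp add: power_mult_distrib)
  then have "1 \<le> 2 * sqrt (real m) * rising_ratio (1/2) m"
    using rising_ratio_nonneg[of "1/2" m] by (intro power2_le_imp_le[of 1]) auto
  then show ?thesis using assms by (simp add: field_simps)
qed

lemma falling_ratio_telescope:
  "a \<le> b \<Longrightarrow> (\<Sum>m=a..<b. falling_ratio n m - falling_ratio n (Suc m)) = falling_ratio n a - falling_ratio n b"
  by (induction rule: dec_induct) auto

lemma floor_sqrt_bounds:
  fixes n :: nat
  defines "k \<equiv> floor_sqrt n"
  assumes "n > 0"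
  shows "k > 0" "k \<le> n" "real k \<le> sqrt (real n)" "sqrt (real n) \<le> real (Suc k)"
proof -
  show "k > 0" "k \<le> n" using assms by (simp_all add: floor_sqrt_le)
  have "k\<^sup>2 \<le> n" by (simp add: k_def)
  then show "real k \<le> sqrt (real n)" by (metis of_nat_le_iff of_nat_power real_le_rsqrt)
  have "n \<le> (Suc k)\<^sup>2" using Suc_floor_sqrt_power2_gt[of n] by (simp add: k_def)
  then have "real n \<le> (real (Suc k))\<^sup>2" by (metis of_nat_le_iff of_nat_power)
  then show "sqrt (real n) \<le> real (Suc k)" by (intro real_le_lsqrt) simp_all
qed

text \<open>The sum is split near \<open>sqrt n\<close>: few cyclic nodes are unlikely, and for many
  of them \<open>rising_ratio\<close> is already small. The two ranges contribute 4 and 1 to the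
  constant 5.\<close>

lemma cycle_mean_upper:
  assumes "n > 0" "0 \<le> z" "z \<le> 1"
  shows "cycle_mean z n \<le> 5 * sqrt (real n) powr (z - 1)"
proof -
  define k where "k = floor_sqrt n"
  note k = floor_sqrt_bounds[OF assms(1), folded k_def]
  define x where "x = sqrt (real n)"
  have x: "x > 0" "x * x = real n" using assms(1) by (simp_all add: x_def)
  let ?g = "\<lambda>m. (falling_ratio n m - falling_ratio n (Suc m)) * rising_ratio z m"
  \<comment> \<open>Exactly \<open>m\<close> cyclic nodes have probability at most
    \<open>m / n\<close>, which offsets the larger values of \<open>rising_ratio\<close>
    here.\<close>
  have "?g m \<le> real (Suc k) powr z / real n" if "m \<le> k" for m
  proof -
    have "falling_ratio n m - falling_ratio n (Suc m) = falling_ratio n m * (real m / real n)"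
      by (simp add: falling_ratio_Suc algebra_simps)
    also have "\<dots> \<le> 1 * (real (Suc m) / real n)"
      using that k by (intro mult_mono falling_ratio_le_1 divide_right_mono) auto
    finally have "?g m \<le> real (Suc m) / real n * real (Suc m) powr (z - 1)"
      using assms by (intro mult_mono rising_ratio_le_powr rising_ratio_nonneg) auto
    also have "\<dots> = real (Suc m) powr z / real n"
      by (simp add: powr_diff)
    also have "\<dots> \<le> real (Suc k) powr z / real n"
      using that assms by (intro divide_right_mono powr_mono2) auto
    finally show ?thesis .
  qed
  then have "(\<Sum>m<Suc k. ?g m) \<le> real (card {..<Suc k}) * (real (Suc k) powr z / real n)"
    by (intro sum_bounded_above) auto
  also have "\<dots> = real (Suc k) * real (Suc k) powr z / real n" by simp
  also have "\<dots> \<le> (2 * x) * (2 * x powr z) / real n"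
  proof (intro divide_right_mono mult_mono)
    \<comment> \<open>As \<open>k\<close> is positive, \<open>Suc k\<close> is at most twice
      \<open>k\<close>, hence at most \<open>2 * x\<close>.\<close>
    show "real (Suc k) \<le> 2 * x" using k by (simp add: x_def)
    then have "real (Suc k) powr z \<le> (2 * x) powr z" using assms by (intro powr_mono2) auto
    also have "\<dots> \<le> 2 * x powr z"
      using assms x powr_mono[of z 1 2] by (simp add: powr_mult mult_right_mono)
    finally show "real (Suc k) powr z \<le> 2 * x powr z" .
  qed (use x in auto)
  also have "\<dots> = 4 * x powr (z - 1)" using x by (simp add: x(2)[symmetric] powr_diff field_simps)
  finally have 1: "(\<Sum>m<Suc k. ?g m) \<le> 4 * x powr (z - 1)" .
  have "(\<Sum>m=Suc k..<Suc n. ?g m) \<le>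
      (\<Sum>m=Suc k..<Suc n. (falling_ratio n m - falling_ratio n (Suc m)) * rising_ratio z k)"
    using assms falling_ratio_mono[of _ n] by (intro sum_mono mult_left_mono rising_ratio_antimono) auto
  also have "\<dots> = (falling_ratio n (Suc k) - falling_ratio n (Suc n)) * rising_ratio z k"
    using k falling_ratio_telescope[of "Suc k" "Suc n" n] by (simp only: sum_distrib_right[symmetric] Suc_le_mono)
  also have "\<dots> \<le> 1 * rising_ratio z k"
    using assms k falling_ratio_le_1[of k n] falling_ratio_mono[of k n] falling_ratio_vanish[of n]
    by (intro mult_right_mono rising_ratio_nonneg) auto
  also have "\<dots> \<le> real (Suc k) powr (z - 1)" using rising_ratio_le_powr[OF assms(2,3)] by simp
  also have "\<dots> \<le> x powr (z - 1)" using k assms x by (intro powr_mono2') (auto simp: x_def)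
  finally have 2: "(\<Sum>m=Suc k..<Suc n. ?g m) \<le> x powr (z - 1)" .
  have "cycle_mean z n = (\<Sum>m<Suc n. ?g m)" by (simp add: cycle_mean_def lessThan_Suc_atMost)
  also have "\<dots> = (\<Sum>m<Suc k. ?g m) + (\<Sum>m=Suc k..<Suc n. ?g m)"
    using k by (simp only: lessThan_atLeast0 sum.atLeastLessThan_concat[symmetric, of 0 "Suc k" "Suc n"] le0 Suc_le_mono)
  finally show ?thesis using 1 2 by (simp add: x_def)
qed

text \<open>With probability at least 1/5 there are at most \<open>k\<close> cyclic nodes, and then
  \<open>rising_ratio\<close> is at least its value at \<open>k\<close>.\<close>

lemma cycle_mean_half_lower:
  assumes "n > 0"
  shows "cycle_mean (1/2) n \<ge> sqrt (real n) powr (- 1/2) / 10"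
proof -
  define k where "k = floor_sqrt n"
  note k = floor_sqrt_bounds[OF assms(1), folded k_def]
  define x where "x = sqrt (real n)"
  have x: "x > 0" "x * x = real n" using assms(1) by (simp_all add: x_def)
  let ?g = "\<lambda>m. (falling_ratio n m - falling_ratio n (Suc m)) * rising_ratio (1/2) m"
  \<comment> \<open>\<open>x \<le> Suc k \<le> 2 * k\<close> makes the exponent in
    \<open>falling_ratio_le_exp\<close> at least 1/4, and \<open>exp (1/4) \<ge> 5/4\<close> yields
    the bound 4/5.\<close>
  have "real k * real (Suc k) \<ge> (x / 2) * x"
    using k x by (intro mult_mono) (auto simp: x_def)
  then have "1/4 \<le> real k * real (Suc k) / (2 * real n)"
    using assms by (subst pos_le_divide_eq) (simp_all add: x(2)[symmetric] x(1))
  then have "falling_ratio n (Suc k) \<le> exp (- (1/4))"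
    using falling_ratio_le_exp[OF k(2)] by (meson exp_le_cancel_iff neg_le_iff_le order_trans)
  also have "\<dots> \<le> 4/5"
    using exp_ge_add_one_self[of "1/4::real"] by (simp add: exp_minus field_simps)
  finally have t: "falling_ratio n (Suc k) \<le> 4/5" .
  have "x powr (- 1/2) / 10 = 1 / (2 * sqrt x) * (1/5)"
    using x by (simp add: powr_minus powr_half_sqrt field_simps)
  also have "\<dots> \<le> 1 / (2 * sqrt (real k)) * (1 - falling_ratio n (Suc k))"
    using t k x by (intro mult_mono divide_left_mono) (auto simp: x_def)
  also have "\<dots> \<le> rising_ratio (1/2) k * (1 - falling_ratio n (Suc k))"
    using t k rising_ratio_half_ge[of k] by (intro mult_right_mono) auto
  also have "\<dots> = (\<Sum>m<Suc k. (falling_ratio n m - falling_ratio n (Suc m)) * rising_ratio (1/2) k)"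
    using falling_ratio_telescope[of 0 "Suc k" n]
    by (simp add: sum_distrib_right[symmetric] lessThan_atLeast0 del: sum.lessThan_Suc sum.op_ivl_Suc)
  also have "\<dots> \<le> (\<Sum>m<Suc k. ?g m)"
    using k falling_ratio_mono[of _ n] by (intro sum_mono mult_left_mono rising_ratio_antimono) auto
  also have "\<dots> \<le> (\<Sum>m<Suc n. ?g m)"
    using k falling_ratio_mono[of _ n] by (intro sum_mono2 mult_nonneg_nonneg rising_ratio_nonneg) auto
  also have "\<dots> = cycle_mean (1/2) n" by (simp add: cycle_mean_def lessThan_Suc_atMost)
  finally show ?thesis by (simp add: x_def)
qed

section \<open>Components of random pseudoforests\<close>

text \<open>\<open>M\<close> does not depend on \<open>z\<close>, so it cancels when sums for two
  values of \<open>z\<close> are compared.\<close>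

lemma sum_pseudoforests:
  assumes "finite S" "card S = n" "n > 0"
  shows "\<exists>M>0. \<forall>z>0. (\<Sum>q\<in>{q \<in> S \<times> {0, 1} \<rightarrow>\<^sub>E {1..n}. pseudoforest (hash_graph n S q)}.
      (2 * z) ^ card (multigraph_components (hash_graph n S q))) = M * cycle_mean z n"
proof -
  let ?Q = "S \<times> {0, 1 :: nat} \<rightarrow>\<^sub>E {1..n}"
  let ?H = "hash_graph n S"
  let ?c = "\<lambda>q. card (multigraph_components (?H q))"
  define M where "M = real (card (S \<rightarrow>\<^sub>E {0, 1 :: nat}) * card {\<pi> \<in> S \<rightarrow>\<^sub>E {1..n}. bij_betw \<pi> S {1..n}})"
  have c: "?c q = component_count {1..n} (adjacency (?H q))" for q
    by (simp add: component_count_def multigraph_components_def hash_graph_def)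
  have finQ: "finite ?Q" using assms by (auto intro!: finite_PiE)
  have "M > 0"
  proof -
    obtain \<pi> where "bij_betw \<pi> S {1..n}"
      using assms finite_same_card_bij[of S "{1..n}"] by auto
    then have "bij_betw (restrict \<pi> S) S {1..n}" by (simp cong: bij_betw_cong)
    moreover from this have "restrict \<pi> S \<in> S \<rightarrow>\<^sub>E {1..n}"
      by (intro restrict_PiE_iff[THEN iffD2] ballI) (use bij_betw_apply in fastforce)
    ultimately
    have "{\<pi> \<in> S \<rightarrow>\<^sub>E {1..n}. bij_betw \<pi> S {1..n}} \<noteq> {}" by blast
    moreover have "finite {\<pi> \<in> S \<rightarrow>\<^sub>E {1..n}. bij_betw \<pi> S {1..n}}"
      using assms by (auto intro!: finite_PiE)
    ultimately have "card {\<pi> \<in> S \<rightarrow>\<^sub>E {1..n}. bij_betw \<pi> S {1..n}} > 0" by (simp add: card_gt_0_iff)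
    moreover have "card (S \<rightarrow>\<^sub>E {0, 1 :: nat}) > 0" using assms by (simp add: card_PiE)
    ultimately show ?thesis unfolding M_def by simp
  qed
  moreover have "(\<Sum>q\<in>{q \<in> ?Q. pseudoforest (?H q)}. (2 * z) ^ ?c q) = M * real n ^ n * cycle_mean z n"
    if "z > 0" for z :: real
  proof -
    \<comment> \<open>A pseudoforest has \<open>2 ^ ?c q\<close> orientations, each of weight
      \<open>z ^ ?c q\<close>; any other graph has none.\<close>
    have per_q: "(\<Sum>b\<in>orientations q S {1..n}. z ^ component_count {1..n} (adjacency (?H q))) =
        (if pseudoforest (?H q) then (2 * z) ^ ?c q else 0)" if q: "q \<in> ?Q" for q
    proof -
      have q': "q \<in> S \<times> {0, 1} \<rightarrow> {1..n}" using q by (simp add: PiE_def)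
      show ?thesis
      proof (cases "orientations q S {1..n} = {}")
        case True
        then show ?thesis using pseudoforest_imp_orientation[OF q' refl assms(1,2)] by auto
      next
        case False
        then obtain b where b: "b \<in> orientations q S {1..n}" by blast
        show ?thesis
          using pseudoforest_orientation[OF q' refl b] card_orientations[OF q' refl b]
          by (simp add: c power_mult_distrib)
      qed
    qed
    have "(\<Sum>q\<in>{q \<in> ?Q. pseudoforest (?H q)}. (2 * z) ^ ?c q) =
        (\<Sum>q\<in>?Q. if pseudoforest (?H q) then (2 * z) ^ ?c q else 0)"
      by (rule sum.inter_filter[OF finQ])
    also have "\<dots> =
        (\<Sum>q\<in>?Q. \<Sum>b\<in>orientations q S {1..n}. z ^ component_count {1..n} (adjacency (?H q)))"
      by (rule sum.cong[OF refl per_q[symmetric]])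
    also have "\<dots> = M * (\<Sum>f\<in>{1..n} \<rightarrow>\<^sub>E {1..n}. z ^ component_count {1..n} (fgraph {1..n} f))"
      unfolding M_def by (rule sum_orientations[OF assms(1) refl])
    also have "\<dots> = M * total_weight z n n"
      using that assms(3) by (subst sum_components[where n = n]) auto
    also have "\<dots> = M * real n ^ n * cycle_mean z n"
      using total_weight_eq_cycle_mean[OF assms(3)] by simp
    finally show ?thesis .
  qed
  ultimately show ?thesis using assms(3) by (intro exI[of _ "M * real n ^ n"]) auto
qed

text \<open>Markov's inequality for \<open>(1/2) ^ ?c q\<close>, with sums evaluated at
  \<open>z = 1/4\<close> and \<open>z = 1/2\<close>.\<close>

lemma prob_many_components:
  assumes "finite S" "card S = n" "n > 0"
  shows "\<P>(q in measure_pmf (random_hash n S).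
            real (card (multigraph_components (hash_graph n S q))) \<ge> 1 / 8 * ln (real n)
            \<bar> pseudoforest (hash_graph n S q)) \<ge> 1 - 50 * real n powr (- ((1 - ln 2) / 8))"
proof -
  define Q where "Q = (S \<times> {0, 1 :: nat} \<rightarrow>\<^sub>E {1..n})"
  let ?c = "\<lambda>q. card (multigraph_components (hash_graph n S q))"
  define t where "t = 1 / 8 * ln (real n)"
  define PF where "PF = {q \<in> Q. pseudoforest (hash_graph n S q)}"
  define Few where "Few = {q \<in> PF. real (?c q) < t}"
  have finQ: "finite Q" unfolding Q_def using assms by (auto intro!: finite_PiE)
  have neQ: "Q \<noteq> {}" unfolding Q_def using assms by (auto simp: PiE_eq_empty_iff)
  have fin: "finite PF" "finite Few" using finQ by (auto simp: PF_def Few_def)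
  obtain M where M: "M > 0" and sums: "\<And>z. z > 0 \<Longrightarrow> (\<Sum>q\<in>PF. (2 * z) ^ ?c q) = M * cycle_mean z n"
    using sum_pseudoforests[OF assms] unfolding PF_def Q_def by blast
  \<comment> \<open>At \<open>z = 1/2\<close> every pseudoforest has weight 1, so the sum counts
    them.\<close>
  have N: "real (card PF) = M * cycle_mean (1/2) n" using sums[of "1/2"] by simp
  have n0: "real n > 0" using assms by simp
  have lower: "cycle_mean (1/2) n \<ge> real n powr (- 1/4) / 10"
    using cycle_mean_half_lower[OF assms(3)] n0 by (simp add: powr_half_sqrt[symmetric] powr_powr)
  have upper: "cycle_mean (1/4) n \<le> 5 * real n powr (- 3/8)"
    using cycle_mean_upper[OF assms(3), of "1/4"] n0 by (simp add: powr_half_sqrt[symmetric] powr_powr)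
  \<comment> \<open>The conditional probability is a genuine quotient only if pseudoforests
    exist.\<close>
  have N0: "card PF > 0"
  proof -
    have "real n powr (- 1/4) / 10 > 0" using n0 by simp
    then have "cycle_mean (1/2) n > 0" using lower by linarith
    then have "real (card PF) > 0" unfolding N using M by simp
    then show ?thesis by simp
  qed
  have "real (card Few) \<le> (\<Sum>q\<in>Few. 2 powr t * (1/2) ^ ?c q)"
  proof -
    have "1 \<le> 2 powr t * (1/2) ^ ?c q" if "q \<in> Few" for q
    proof -
      have "1 \<le> 2 powr (t - real (?c q))" using that by (intro ge_one_powr_ge_zero) (simp_all add: Few_def)
      then show ?thesis by (simp add: powr_diff powr_realpow power_one_over)
    qed
    from sum_mono[of Few "\<lambda>_. 1", OF this] show ?thesis by simp
  qed
  also have "\<dots> \<le> (\<Sum>q\<in>PF. 2 powr t * (1/2) ^ ?c q)"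
    using fin by (intro sum_mono2) (auto simp: Few_def)
  also have "\<dots> = 2 powr t * (M * cycle_mean (1/4) n)"
    using sums[of "1/4"] by (simp add: sum_distrib_left[symmetric])
  also have "\<dots> \<le> 2 powr t * (M * (5 * real n powr (- 3/8)))"
    using M upper by (intro mult_left_mono) auto
  \<comment> \<open>The constant is 5 times 10, from the upper and the lower estimate;
    \<open>2 powr t\<close> contributes the exponent \<open>ln 2 / 8\<close>, and
    \<open>3/8 - 1/4 = 1/8\<close>.\<close>
  also have "\<dots> = 50 * real n powr (- ((1 - ln 2) / 8)) * (M * (real n powr (- 1/4) / 10))"
  proof -
    have "2 powr t = real n powr (ln 2 / 8)" using n0 by (simp add: powr_def t_def)
    moreover have "real n powr (ln 2 / 8) * real n powr (- 3/8) = real n powr (- ((1 - ln 2) / 8)) * real n powr (- 1/4)"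
      unfolding powr_add[symmetric] by (intro arg_cong[of _ _ "(powr) (real n)"]) (simp add: field_simps)
    ultimately show ?thesis by (simp add: algebra_simps)
  qed
  also have "\<dots> \<le> 50 * real n powr (- ((1 - ln 2) / 8)) * real (card PF)"
    unfolding N using M lower by (intro mult_left_mono) auto
  finally have few: "real (card Few) \<le> 50 * real n powr (- ((1 - ln 2) / 8)) * real (card PF)" .
  have "{q \<in> Q. real (?c q) \<ge> t \<and> pseudoforest (hash_graph n S q)} = PF - Few"
    by (auto simp: PF_def Few_def)
  moreover have "card (PF - Few) = card PF - card Few" "card Few \<le> card PF"
    using fin by (auto simp: Few_def intro!: card_Diff_subset card_mono)
  ultimately have many: "real (card (Q \<inter> {q. real (?c q) \<ge> t \<and> pseudoforest (hash_graph n S q)})) =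
      real (card PF) - real (card Few)"
    by (simp add: Int_def of_nat_diff)
  have all: "Q \<inter> {q. pseudoforest (hash_graph n S q)} = PF" by (auto simp: PF_def)
  have "\<P>(q in measure_pmf (random_hash n S). real (?c q) \<ge> t \<bar> pseudoforest (hash_graph n S q))
      = (real (card PF) - real (card Few)) / real (card PF)"
  proof -
    have "random_hash n S = pmf_of_set Q" by (simp only: random_hash_def Q_def)
    then show ?thesis using many all finQ neQ
      by (simp add: cond_prob_def measure_pmf_of_set)
  qed
  also have "\<dots> \<ge> 1 - 50 * real n powr (- ((1 - ln 2) / 8))"
    using few N0 by (simp add: field_simps)
  finally show ?thesis by (simp add: t_def)
qed

theorem theorem4p12:
  fixes S :: "nat \<Rightarrow> 'a set"
  assumes "\<And>n. finite (S n)" and "\<And>n. card (S n) = n"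
  shows "(\<lambda>n. \<P>(q in measure_pmf (random_hash n (S n)).
            real (card (multigraph_components (hash_graph n (S n) q))) \<ge> 1 / 8 * ln (real n)
            \<bar> pseudoforest (hash_graph n (S n) q)))
         \<in> \<Omega>(\<lambda>_. 1 :: real)"
proof (rule landau_omega.bigI[of "1/2"])
  have "(\<lambda>n. real n powr (- ((1 - ln 2) / 8))) \<longlonglongrightarrow> 0"
    using ln_2_less_1 by (intro tendsto_neg_powr filterlim_real_sequentially) simp
  \<comment> \<open>Below 1/100 the error term \<open>50 * ...\<close> is less than 1/2, which
    leaves probability at least 1/2.\<close>
  then have "\<forall>\<^sub>F n in sequentially. real n powr (- ((1 - ln 2) / 8)) < 1/100"
    by (rule order_tendstoD) simp
  then show "\<forall>\<^sub>F n in sequentially. norm (\<P>(q in measure_pmf (random_hash n (S n)).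
            real (card (multigraph_components (hash_graph n (S n) q))) \<ge> 1 / 8 * ln (real n)
            \<bar> pseudoforest (hash_graph n (S n) q))) \<ge> 1/2 * norm (1 :: real)"
    using eventually_gt_at_top[of 0]
  proof eventually_elim
    case (elim n)
    then show ?case using prob_many_components[OF assms elim(2)] by simp
  qed
qed simp

end
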